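(* Let $\Sigma=\{0,1\}^{\mathbb N}$, let $\mathcal N\subset\Sigma$ be the set of normal sequences, and for $\alpha\in[0,1]$ let $A_\alpha=\{\omega\in\Sigma:\lim_{n\to\infty}\frac1n\sum_{k=1}^n\omega_k\omega_{2k}=\alpha\}$, $A=\{\omega\in\Sigma:\omega_k\omega_{2k}=0\text{ for all }k\ge1\}$, $B=\{\omega\in\Sigma:\omega_k=\omega_{2k}\text{ for all }k\ge1\}$. Then: (i) for $0\le\alpha\le 1/2$, $h_{\rm top}(\mathcal N\cap A_\alpha)=\frac12\log 2+\frac12H(2\alpha)$, where $H(t)=-t\log t-(1-t)\log(1-t)$; (ii) for $\alpha>1/2$, the set $\mathcal N\cap A_\alpha$ is empty; (iii) $h_{\rm top}(\mathcal N\cap A)=h_{\rm top}(\mathcal N\cap A_0)=\frac12\log 2$; (iv) $\mathcal N\cap B\subset A_{1/2}$, and $h_{\rm top}(\mathcal N\cap B)=h_{\rm top}(\mathcal N\cap A_{1/2})=h_{\rm top}(B)=\frac12\log 2$.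
   Context: $\mathbb N=\{1,2,\dots\}$; elements of $\Sigma$ are written $\omega=(\omega_k)_{k\ge1}$. A sequence $\omega\in\Sigma$ is normal if for every $n\ge1$ each word $w\in\{0,1\}^n$ occurs in $\omega$ with asymptotic frequency $2^{-n}$. $H(0)=H(1)=0$. For $\omega\in\Sigma$ and $n\ge1$ let $C_n(\omega)=\{\tau\in\Sigma:\tau_i=\omega_i,\ 1\le i\le n\}$ (cylinder of order $n$). For $E\subset\Sigma$ the (Bowen) topological entropy $h_{\rm top}(E)$ (for the left shift on $\Sigma$ with metric $d(\omega,\tau)=2^{-\min\{n\ge0:\omega_{n+1}\ne\tau_{n+1}\}}$) is: for $s\ge0$, $N\ge1$, $\mathcal H^s_N(E)=\inf\sum_i e^{-sn_i}$ over all finite or countable families of cylinders $C_{n_i}(x_i)$ with $n_i\ge N$ covering $E$; $\mathcal H^s(E)=\lim_{N\to\infty}\mathcal H^s_N(E)$; $h_{\rm top}(E)$ is the critical value of $s$ where $\mathcal H^s(E)$ jumps from $+\infty$ to $0$. Equivalently $h_{\rm top}(E)=(\log 2)\dim_H E$. *)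

theory Defs
  imports "HOL-Analysis.Analysis"
begin

text \<open>
  A point of \<open>{0,1}\<^sup>\<nat>\<close>, with \<open>\<nat> = {1, 2, ...}\<close>, is a function that is extensional on
  \<open>{1..}\<close>; its value at the index 0 is the dummy \<^const>\<open>undefined\<close> and never matters.
\<close>

definition bin_seqs :: "(nat \<Rightarrow> nat) set" where
  "bin_seqs = {1..} \<rightarrow>\<^sub>E {0, 1}"

text \<open>\<open>k\<close> is the position in \<open>\<omega>\<close> of the first letter of an occurrence of \<open>w\<close>.\<close>

definition occurrences :: "nat list \<Rightarrow> (nat \<Rightarrow> nat) \<Rightarrow> nat \<Rightarrow> nat set" where
  "occurrences w \<omega> N = {k \<in> {1..N}. \<forall>i<length w. \<omega> (k + i) = w ! i}"

definition normal_seqs :: "(nat \<Rightarrow> nat) set" where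
  "normal_seqs = {\<omega> \<in> bin_seqs. \<forall>n\<ge>1. \<forall>w. length w = n \<and> set w \<subseteq> {0, 1} \<longrightarrow>
     (\<lambda>N. real (card (occurrences w \<omega> N)) / real N) \<longlonglongrightarrow> 1 / 2 ^ n}"

definition level_set :: "real \<Rightarrow> (nat \<Rightarrow> nat) set" where
  "level_set \<alpha> = {\<omega> \<in> bin_seqs.
     (\<lambda>n. (1 / real n) * (\<Sum>k=1..n. real (\<omega> k * \<omega> (2 * k)))) \<longlonglongrightarrow> \<alpha>}"

definition zero_product_seqs :: "(nat \<Rightarrow> nat) set" where
  "zero_product_seqs = {\<omega> \<in> bin_seqs. \<forall>k\<ge>1. \<omega> k * \<omega> (2 * k) = 0}"

definition doubling_invariant_seqs :: "(nat \<Rightarrow> nat) set" where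
  "doubling_invariant_seqs = {\<omega> \<in> bin_seqs. \<forall>k\<ge>1. \<omega> k = \<omega> (2 * k)}"

definition bin_entropy :: "real \<Rightarrow> real" where
  "bin_entropy t = - t * ln t - (1 - t) * ln (1 - t)"

lemma bin_entropy_0 [simp]: "bin_entropy 0 = 0"
  and bin_entropy_1 [simp]: "bin_entropy 1 = 0"
  by (simp_all add: bin_entropy_def)

definition cylinder :: "nat \<Rightarrow> (nat \<Rightarrow> nat) \<Rightarrow> (nat \<Rightarrow> nat) set" where
  "cylinder n \<omega> = {\<tau> \<in> bin_seqs. \<forall>i\<in>{1..n}. \<tau> i = \<omega> i}"

text \<open>
  The families are indexed by arbitrary sets of natural numbers, hence are finite or countable.
\<close>

definition entropy_premeasure :: "real \<Rightarrow> nat \<Rightarrow> (nat \<Rightarrow> nat) set \<Rightarrow> ennreal" where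
  "entropy_premeasure s N E =
     Inf {(\<Sum>\<^sub>\<infinity>i\<in>I. ennreal (exp (- s * real (n i)))) | (I :: nat set) n x.
        (\<forall>i\<in>I. n i \<ge> N \<and> x i \<in> bin_seqs) \<and> E \<subseteq> (\<Union>i\<in>I. cylinder (n i) (x i))}"

definition entropy_measure :: "real \<Rightarrow> (nat \<Rightarrow> nat) set \<Rightarrow> ennreal" where
  "entropy_measure s E = lim (\<lambda>N. entropy_premeasure s N E)"

text \<open>
  The critical exponent; the lemmas \<open>entropy_measure_above\<close> and \<open>entropy_measure_below\<close> confirm
  that the measure jumps from \<open>\<infinity>\<close> to \<open>0\<close> there.
\<close>

definition h_top :: "(nat \<Rightarrow> nat) set \<Rightarrow> real" where
  "h_top E = Inf {s. s \<ge> 0 \<and> entropy_measure s E = 0}"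

lemma entropy_premeasure_mono: "N \<le> M \<Longrightarrow> entropy_premeasure s N E \<le> entropy_premeasure s M E"
  unfolding entropy_premeasure_def
  by (intro Inf_superset_mono Collect_mono) (intro impI, elim ex_forward conj_forward, auto)

lemma entropy_premeasure_tendsto:
  "(\<lambda>N. entropy_premeasure s N E) \<longlonglongrightarrow> (SUP N. entropy_premeasure s N E)"
  by (intro LIMSEQ_SUP monoI entropy_premeasure_mono)

lemma entropy_measure_eq_SUP: "entropy_measure s E = (SUP N. entropy_premeasure s N E)"
  unfolding entropy_measure_def by (intro limI entropy_premeasure_tendsto)

lemma entropy_measure_tendsto: "(\<lambda>N. entropy_premeasure s N E) \<longlonglongrightarrow> entropy_measure s E"
  unfolding entropy_measure_eq_SUP by (rule entropy_premeasure_tendsto)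

lemma entropy_premeasure_le_measure: "entropy_premeasure s N E \<le> entropy_measure s E"
  unfolding entropy_measure_eq_SUP by (rule SUP_upper) simp

lemma entropy_premeasure_le:
  fixes I :: "nat set"
  assumes "\<And>i. i \<in> I \<Longrightarrow> n i \<ge> N \<and> x i \<in> bin_seqs"
    and "E \<subseteq> (\<Union>i\<in>I. cylinder (n i) (x i))"
  shows "entropy_premeasure s N E \<le> (\<Sum>\<^sub>\<infinity>i\<in>I. ennreal (exp (- s * real (n i))))"
  unfolding entropy_premeasure_def by (rule Inf_lower) (use assms in blast)

lemma entropy_premeasure_scale:
  assumes "s \<le> t"
  shows "ennreal (exp ((t - s) * real N)) * entropy_premeasure t N E \<le> entropy_premeasure s N E"
  unfolding entropy_premeasure_def [of s]
proof (rule Inf_greatest, clarify)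
  fix I :: "nat set" and n x
  assume *: "\<forall>i\<in>I. n i \<ge> N \<and> x i \<in> bin_seqs" "E \<subseteq> (\<Union>i\<in>I. cylinder (n i) (x i))"
  have "ennreal (exp ((t - s) * real N)) * entropy_premeasure t N E
      \<le> ennreal (exp ((t - s) * real N)) * (\<Sum>\<^sub>\<infinity>i\<in>I. ennreal (exp (- t * real (n i))))"
    using * by (intro mult_left_mono entropy_premeasure_le) auto
  also have "\<dots> = (\<Sum>\<^sub>\<infinity>i\<in>I. ennreal (exp ((t - s) * real N)) * ennreal (exp (- t * real (n i))))"
    by (simp add: nonneg_infsum_complete SUP_mult_left_ennreal sum_distrib_left del: sum_ennreal)
  also have "\<dots> \<le> (\<Sum>\<^sub>\<infinity>i\<in>I. ennreal (exp (- s * real (n i))))"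
  proof (rule infsum_mono)
    fix i assume "i \<in> I"
    with * have "(t - s) * real N \<le> (t - s) * real (n i)"
      using assms by (intro mult_left_mono) auto
    then have "exp ((t - s) * real N + - t * real (n i)) \<le> exp (- s * real (n i))"
      by (simp add: algebra_simps)
    then show "ennreal (exp ((t - s) * real N)) * ennreal (exp (- t * real (n i)))
        \<le> ennreal (exp (- s * real (n i)))"
      unfolding exp_add by (subst ennreal_mult [symmetric]) (auto intro: ennreal_leI)
  qed (auto intro!: nonneg_summable_on_complete)
  finally show "ennreal (exp ((t - s) * real N)) * entropy_premeasure t N E
      \<le> (\<Sum>\<^sub>\<infinity>i\<in>I. ennreal (exp (- s * real (n i))))" .
qed

lemma entropy_measure_eq_0:
  assumes "s < t" "entropy_measure s E \<noteq> \<infinity>"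
  shows "entropy_measure t E = 0"
proof -
  obtain c where c: "entropy_measure s E = ennreal c" "c \<ge> 0"
    using assms(2) by (cases "entropy_measure s E") auto
  have le: "entropy_premeasure t N E \<le> ennreal (exp (- (t - s) * real N) * c)" for N
  proof -
    have "entropy_premeasure t N E
        = ennreal (exp (- (t - s) * real N)) * (ennreal (exp ((t - s) * real N)) * entropy_premeasure t N E)"
      unfolding mult.assoc [symmetric]
      by (subst ennreal_mult [symmetric]) (simp_all flip: exp_add distrib_right)
    also have "\<dots> \<le> ennreal (exp (- (t - s) * real N)) * ennreal c"
      using assms(1) c entropy_premeasure_scale [of s t N E] entropy_premeasure_le_measure [of s N E]
      by (intro mult_left_mono) auto
    finally show ?thesis using c by (simp add: ennreal_mult)
  qed
  have "(\<lambda>N. exp (- (t - s)) ^ N * c) \<longlonglongrightarrow> 0 * c"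
    using assms(1) by (intro tendsto_mult LIMSEQ_power_zero tendsto_const) auto
  then have "(\<lambda>N. ennreal (exp (- (t - s) * real N) * c)) \<longlonglongrightarrow> ennreal 0"
    by (intro tendsto_ennrealI) (simp add: exp_of_nat2_mult)
  then have "entropy_measure t E \<le> ennreal 0"
    by (rule LIMSEQ_le [OF entropy_measure_tendsto]) (use le in blast)
  then show ?thesis by simp
qed

lemma entropy_measure_one_finite:
  assumes "E \<subseteq> bin_seqs"
  shows "entropy_measure 1 E \<noteq> \<infinity>"
proof -
  have "entropy_premeasure 1 N E \<le> 1" for N
  proof -
    define pad where "pad f = (\<lambda>k. if k = 0 then undefined else if k \<le> N then f k else (0::nat))"
      for f :: "nat \<Rightarrow> nat"
    define F where "F = pad ` ({1..N} \<rightarrow>\<^sub>E {0, 1})"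
    have fin: "finite F" unfolding F_def by (intro finite_imageI finite_PiE) auto
    have "card F \<le> card ({1..N} \<rightarrow>\<^sub>E {0, 1::nat})"
      unfolding F_def by (intro card_image_le finite_PiE) auto
    also have "\<dots> = 2 ^ N" by (simp add: card_PiE numeral_2_eq_2)
    finally have card: "card F \<le> 2 ^ N" .
    have F: "F \<subseteq> bin_seqs"
      unfolding F_def bin_seqs_def pad_def by (force simp: PiE_iff extensional_def)
    obtain x where x: "bij_betw x {0..<card F} F"
      using ex_bij_betw_nat_finite [OF fin] by blast
    have "E \<subseteq> (\<Union>i\<in>{0..<card F}. cylinder N (x i))"
    proof
      fix \<tau> assume "\<tau> \<in> E"
      then have \<tau>: "\<tau> \<in> bin_seqs" using assms by blast
      then have "restrict \<tau> {1..N} \<in> {1..N} \<rightarrow>\<^sub>E {0, 1}"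
        by (auto simp: bin_seqs_def PiE_iff)
      then have "pad (restrict \<tau> {1..N}) \<in> F" unfolding F_def by blast
      then obtain i where "i \<in> {0..<card F}" "x i = pad (restrict \<tau> {1..N})"
        using x by (metis bij_betw_imp_surj_on imageE)
      moreover have "\<tau> \<in> cylinder N (pad (restrict \<tau> {1..N}))"
        using \<tau> by (auto simp: cylinder_def pad_def)
      ultimately show "\<tau> \<in> (\<Union>i\<in>{0..<card F}. cylinder N (x i))" by fastforce
    qed
    then have "entropy_premeasure 1 N E \<le> (\<Sum>\<^sub>\<infinity>i\<in>{0..<card F}. ennreal (exp (- 1 * real N)))"
      using F x by (intro entropy_premeasure_le) (auto simp: bij_betw_def)
    also have "\<dots> = ennreal (real (card F) * exp (- real N))"
      by (simp add: ennreal_mult ennreal_of_nat_eq_real_of_nat)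
    also have "\<dots> \<le> ennreal 1"
    proof (rule ennreal_leI)
      have "real (card F) \<le> 2 ^ N"
        using card by (metis of_nat_le_iff of_nat_numeral of_nat_power)
      also have "\<dots> \<le> exp 1 ^ N"
        using exp_ge_add_one_self [of 1] by (intro power_mono) auto
      also have "\<dots> = exp (real N)" by (simp flip: exp_of_nat_mult)
      finally show "real (card F) * exp (- real N) \<le> 1"
        by (simp add: exp_minus field_simps)
    qed
    finally show ?thesis by simp
  qed
  then have "entropy_measure 1 E \<le> 1" unfolding entropy_measure_eq_SUP by (intro SUP_least)
  then show ?thesis by (metis ennreal_one_neq_top infinity_ennreal_def top.extremum_unique)
qed

lemma entropy_measure_above:
  assumes "E \<subseteq> bin_seqs" "h_top E < s"
  shows "entropy_measure s E = 0"
proof -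
  have "entropy_measure 2 E = 0"
    using entropy_measure_one_finite [OF assms(1)] by (intro entropy_measure_eq_0 [of 1]) auto
  then have "{s. s \<ge> 0 \<and> entropy_measure s E = 0} \<noteq> {}" by force
  from cInf_lessD [OF this assms(2) [unfolded h_top_def]]
  obtain r where "r < s" "entropy_measure r E = 0" by auto
  then show ?thesis by (intro entropy_measure_eq_0 [of r s]) auto
qed

lemma entropy_measure_below:
  assumes "0 \<le> s" "s < h_top E"
  shows "entropy_measure s E = \<infinity>"
proof (rule ccontr)
  assume fin: "entropy_measure s E \<noteq> \<infinity>"
  obtain t where t: "s < t" "t < h_top E" using assms(2) dense by blast
  have "entropy_measure t E = 0" using entropy_measure_eq_0 [OF t(1) fin] .
  then have "h_top E \<le> t"
    unfolding h_top_def using assms(1) t by (intro cInf_lower bdd_belowI [of _ 0]) auto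
  with t show False by simp
qed

end

theory Submission
  imports Defs "HOL-Probability.Probability"
begin

text \<open>
  Put \<open>\<xi>\<^sub>k = \<omega>\<^sub>k + \<omega>\<^bsub>2k\<^esub>\<close> modulo 2, so that \<open>\<omega>\<^sub>k \<omega>\<^bsub>2k\<^esub> = (\<omega>\<^sub>k + \<omega>\<^bsub>2k\<^esub> - \<xi>\<^sub>k) / 2\<close>. In a normal sequence both the letters
  \<open>\<omega>\<^sub>k\<close> and the letters \<open>\<omega>\<^bsub>2k\<^esub>\<close> have mean \<open>1/2\<close>, hence a normal \<open>\<omega>\<close> lies in \<open>A\<^sub>\<alpha>\<close> iff the \<open>\<xi>\<^sub>k\<close> have mean
  \<open>q = 1 - 2\<alpha>\<close>. The letters at odd positions together with the \<open>\<xi>\<^sub>k\<close> determine \<open>\<omega>\<close> in a triangular way;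
  let them be independent, fair coins at odd positions and coins of bias \<open>q\<close> for \<open>\<xi>\<^sub>k\<close>. If the \<open>\<xi>\<^sub>k\<close> have mean
  \<open>q\<close>, the cylinder of order \<open>n\<close> around \<open>\<omega>\<close> has mass \<open>exp (- n (log 2 + H(q)) / 2 + o(n))\<close>; this gives the
  upper bound (with a bias close to \<open>q\<close> when \<open>q\<close> is 0 or 1). Almost every sequence is normal and has \<open>\<xi>\<close>-mean \<open>q\<close>,
  by a second moment estimate for Walsh functions, so the mass distribution principle gives the lower bound.
\<close>

section \<open>Normality and Walsh functions\<close>

text \<open>Splitting off the first letter factors the sum, by induction on the length. This is
  Fubini for words; it yields both the orthogonality of Walsh characters and the total mass of the
  coin weights.\<close>

lemma sum_lists_prod:
  fixes g :: "nat \<Rightarrow> 'a \<Rightarrow> 'b::comm_semiring_1"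
  shows "(\<Sum>w | length w = n \<and> set w \<subseteq> A. \<Prod>i<n. g i (w ! i)) = (\<Prod>i<n. \<Sum>a\<in>A. g i a)"
proof (induction n arbitrary: g)
  case 0
  have "{w. length w = 0 \<and> set w \<subseteq> A} = {[]}" by auto
  then show ?case by simp
next
  case (Suc n)
  have *: "{w. length w = Suc n \<and> set w \<subseteq> A}
      = (\<lambda>(w, a). a # w) ` ({w. length w = n \<and> set w \<subseteq> A} \<times> A)"
    by (auto simp: length_Suc_conv image_iff)
  have "(\<Sum>w | length w = Suc n \<and> set w \<subseteq> A. \<Prod>i<Suc n. g i (w ! i))
      = (\<Sum>(w, a)\<in>{w. length w = n \<and> set w \<subseteq> A} \<times> A. g 0 a * (\<Prod>i<n. g (Suc i) (w ! i)))"
    unfolding * by (subst sum.reindex)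
      (auto simp: inj_on_def prod.lessThan_Suc_shift case_prod_unfold simp del: prod.lessThan_Suc intro!: sum.cong)
  also have "\<dots> = (\<Sum>w | length w = n \<and> set w \<subseteq> A. (\<Sum>a\<in>A. g 0 a) * (\<Prod>i<n. g (Suc i) (w ! i)))"
    by (subst sum.cartesian_product [symmetric]) (simp add: sum_distrib_right)
  also have "\<dots> = (\<Prod>i<Suc n. \<Sum>a\<in>A. g i a)"
    by (simp add: Suc.IH [of "\<lambda>i. g (Suc i)"] prod.lessThan_Suc_shift sum_distrib_left [symmetric] del: prod.lessThan_Suc)
  finally show ?case .
qed

lemma bin_seqs_values: "\<omega> \<in> bin_seqs \<Longrightarrow> k \<ge> 1 \<Longrightarrow> \<omega> k = 0 \<or> \<omega> k = 1"
  unfolding bin_seqs_def by (force simp: PiE_iff)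

text \<open>The Walsh character with offsets \<open>F\<close>, evaluated on the window of \<omega>
  that starts at \<open>k\<close>; letters 0 and 1 become the signs 1 and -1.\<close>

definition walsh :: "nat set \<Rightarrow> (nat \<Rightarrow> nat) \<Rightarrow> nat \<Rightarrow> real" where
  "walsh F \<omega> k = (\<Prod>i\<in>F. 1 - 2 * real (\<omega> (k + i)))"

lemma card_occurrences_eq_sum:
  "real (card (occurrences w \<omega> N)) = (\<Sum>k=1..N. if \<forall>i<length w. \<omega> (k + i) = w ! i then 1 else 0)"
  unfolding occurrences_def
  by (subst sum.inter_filter [symmetric]) auto

text \<open>The character depends only on a window of some fixed length \<open>n\<close>, so its
  average is a finite linear combination of word frequencies. In the limit all words of length
  \<open>n\<close> weigh the same, and a nontrivial character sums to 0 over them.\<close>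

lemma walsh_average_tendsto_0_if_normal:
  assumes "\<omega> \<in> normal_seqs" "finite F" "F \<noteq> {}"
  shows "(\<lambda>N. (\<Sum>k=1..N. walsh F \<omega> k) / real N) \<longlonglongrightarrow> 0"
proof -
  obtain n where n: "F \<subseteq> {..<n}"
    using finite_nat_bounded [OF assms(2)] by blast
  with assms(3) have n1: "n \<ge> 1" by (cases n) auto
  define W where "W = {w::nat list. length w = n \<and> set w \<subseteq> {0, 1}}"
  have finW: "finite W" unfolding W_def using finite_lists_length_eq [of "{0, 1::nat}" n]
    by (simp add: conj_commute)
  define c where "c w = (\<Prod>i\<in>F. 1 - 2 * real (w ! i))" for w :: "nat list"
  have bin: "\<omega> \<in> bin_seqs" using assms(1) by (simp add: normal_seqs_def)
  \<comment> \<open>Exactly one word of \<open>W\<close> matches at \<open>k\<close>, namely the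
    window \<open>?v\<close> itself.\<close>
  have walsh: "walsh F \<omega> k = (\<Sum>w\<in>W. c w * (if \<forall>i<length w. \<omega> (k + i) = w ! i then 1 else 0))"
    if "k \<ge> 1" for k
  proof -
    let ?v = "map (\<lambda>i. \<omega> (k + i)) [0..<n]"
    have "\<omega> (k + i) \<in> {0, 1}" for i using that bin bin_seqs_values [of \<omega> "k + i"] by auto
    then have "set ?v \<subseteq> {0, 1}" unfolding set_map by (rule image_subsetI)
    then have v: "?v \<in> W" by (simp add: W_def)
    have "(\<Sum>w\<in>W. c w * (if \<forall>i<length w. \<omega> (k + i) = w ! i then 1 else 0))
        = (\<Sum>w\<in>W. if w = ?v then c w else 0)"
    proof (rule sum.cong)
      fix w assume "w \<in> W"
      then have "(\<forall>i<length w. \<omega> (k + i) = w ! i) \<longleftrightarrow> w = ?v"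
        by (auto simp: W_def list_eq_iff_nth_eq)
      then show "c w * (if \<forall>i<length w. \<omega> (k + i) = w ! i then 1 else 0) = (if w = ?v then c w else 0)"
        by simp
    qed simp
    also have "\<dots> = c ?v" using v finW by simp
    also have "\<dots> = walsh F \<omega> k" unfolding c_def walsh_def using n by (intro prod.cong) auto
    finally show ?thesis by simp
  qed
  have "(\<lambda>N. \<Sum>w\<in>W. c w * (real (card (occurrences w \<omega> N)) / real N)) \<longlonglongrightarrow> (\<Sum>w\<in>W. c w * (1 / 2 ^ n))"
    using assms(1) n1 by (intro tendsto_sum tendsto_mult_left) (auto simp: normal_seqs_def W_def)
  also have "(\<lambda>N. \<Sum>w\<in>W. c w * (real (card (occurrences w \<omega> N)) / real N))
      = (\<lambda>N. (\<Sum>k=1..N. walsh F \<omega> k) / real N)"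
  proof
    fix N
    have "(\<Sum>k=1..N. walsh F \<omega> k) = (\<Sum>k=1..N. \<Sum>w\<in>W. c w * (if \<forall>i<length w. \<omega> (k + i) = w ! i then 1 else 0))"
      by (intro sum.cong refl walsh) auto
    also have "\<dots> = (\<Sum>w\<in>W. c w * real (card (occurrences w \<omega> N)))"
      unfolding card_occurrences_eq_sum by (subst sum.swap) (simp add: sum_distrib_left)
    finally show "(\<Sum>w\<in>W. c w * (real (card (occurrences w \<omega> N)) / real N)) = (\<Sum>k=1..N. walsh F \<omega> k) / real N"
      by (simp add: sum_divide_distrib)
  qed
  also have "(\<Sum>w\<in>W. c w * (1 / 2 ^ n)) = 0"
  proof -
    have "(\<Sum>w\<in>W. c w) = (\<Sum>w\<in>W. \<Prod>i<n. if i \<in> F then 1 - 2 * real (w ! i) else 1)"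
      unfolding c_def using n by (intro sum.cong refl) (simp add: prod.inter_restrict [symmetric] Int_absorb1)
    also have "\<dots> = (\<Prod>i<n. \<Sum>a\<in>{0, 1}. if i \<in> F then 1 - 2 * real a else 1)"
      unfolding W_def by (rule sum_lists_prod)
    \<comment> \<open>The factor at any index in \<open>F\<close> is 1 + (-1).\<close>
    also have "\<dots> = 0" using n assms(3) by (intro prod_zero) force+
    finally show ?thesis by (simp flip: sum_divide_distrib)
  qed
  finally show ?thesis .
qed

text \<open>Fourier inversion: the indicator of a word is a combination of the Walsh characters of
  its window. In the limit only the trivial character survives, with coefficient
  \<open>1 / 2 ^ n\<close>.\<close>

lemma normal_if_walsh_average_tendsto_0:
  assumes bin: "\<omega> \<in> bin_seqs"
    and walsh: "\<And>F. finite F \<Longrightarrow> F \<noteq> {} \<Longrightarrow> (\<lambda>N. (\<Sum>k=1..N. walsh F \<omega> k) / real N) \<longlonglongrightarrow> 0"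
  shows "\<omega> \<in> normal_seqs"
  unfolding normal_seqs_def
proof (safe intro!: bin)
  fix w :: "nat list" assume w: "set w \<subseteq> {0, 1}"
  define n where "n = length w"
  define e where "e F = (\<Prod>i\<in>F. 1 - 2 * real (w ! i))" for F
  have ind: "(if \<forall>i<length w. \<omega> (k + i) = w ! i then 1 else 0) = (\<Sum>F\<in>Pow {..<n}. e F * walsh F \<omega> k) / 2 ^ n"
    if "k \<ge> 1" for k
  proof -
    have "(if \<forall>i<length w. \<omega> (k + i) = w ! i then 1 else 0)
        = (\<Prod>i<n. if \<omega> (k + i) = w ! i then 1 else (0::real))"
      by (auto simp: n_def prod_zero_iff)
    \<comment> \<open>For two signs, (st + 1) / 2 is the indicator of s = t. Expanding the product
      over subsets of the window produces the characters.\<close>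
    also have "\<dots> = (\<Prod>i<n. ((1 - 2 * real (w ! i)) * (1 - 2 * real (\<omega> (k + i))) + 1) / 2)"
    proof (rule prod.cong)
      fix i assume "i \<in> {..<n}"
      then have "w ! i \<in> {0, 1}" using w by (auto simp: n_def dest!: nth_mem)
      then show "(if \<omega> (k + i) = w ! i then 1 else 0)
          = ((1 - 2 * real (w ! i)) * (1 - 2 * real (\<omega> (k + i))) + 1) / 2"
        using that bin_seqs_values [OF bin, of "k + i"] by auto
    qed simp
    also have "\<dots> = (\<Prod>i<n. (1 - 2 * real (w ! i)) * (1 - 2 * real (\<omega> (k + i))) + 1) / 2 ^ n"
      by (simp add: prod_dividef)
    also have "(\<Prod>i<n. (1 - 2 * real (w ! i)) * (1 - 2 * real (\<omega> (k + i))) + 1)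
        = (\<Sum>F\<in>Pow {..<n}. e F * walsh F \<omega> k)"
      by (subst prod_add) (simp_all add: e_def walsh_def prod.distrib)
    finally show ?thesis .
  qed
  have "(\<lambda>N. (\<Sum>F\<in>Pow {..<n}. e F * ((\<Sum>k=1..N. walsh F \<omega> k) / real N)) / 2 ^ n)
      \<longlonglongrightarrow> (\<Sum>F\<in>Pow {..<n}. e F * (if F = {} then 1 else 0)) / 2 ^ n"
  proof (intro tendsto_intros)
    fix F assume F: "F \<in> Pow {..<n}"
    show "(\<lambda>N. (\<Sum>k=1..N. walsh F \<omega> k) / real N) \<longlonglongrightarrow> (if F = {} then 1 else 0)"
    proof (cases "F = {}")
      case True
      \<comment> \<open>Only eventually, because at \<open>N = 0\<close> the quotient is 0 by
        convention.\<close>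
      have "eventually (\<lambda>N. (\<Sum>k=1..N. walsh F \<omega> k) / real N = 1) sequentially"
        using eventually_gt_at_top [of 0] by eventually_elim (simp add: True walsh_def)
      then show ?thesis using True by (simp add: tendsto_eventually)
    next
      case False
      moreover have "finite F" using F by (auto intro: finite_subset)
      ultimately show ?thesis using walsh [of F] by simp
    qed
  qed simp_all
  also have "(\<Sum>F\<in>Pow {..<n}. e F * (if F = {} then 1 else 0)) = 1"
  proof -
    have "(\<Sum>F\<in>Pow {..<n}. e F * (if F = {} then 1 else 0)) = (\<Sum>F\<in>Pow {..<n}. if F = {} then 1 else 0)"
      by (intro sum.cong) (auto simp: e_def)
    then show ?thesis by simp
  qed
  also have "(\<lambda>N. (\<Sum>F\<in>Pow {..<n}. e F * ((\<Sum>k=1..N. walsh F \<omega> k) / real N)) / 2 ^ n)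
      = (\<lambda>N. real (card (occurrences w \<omega> N)) / real N)"
  proof
    fix N
    have "real (card (occurrences w \<omega> N)) = (\<Sum>k=1..N. (\<Sum>F\<in>Pow {..<n}. e F * walsh F \<omega> k) / 2 ^ n)"
      unfolding card_occurrences_eq_sum by (intro sum.cong refl ind) auto
    also have "\<dots> = (\<Sum>F\<in>Pow {..<n}. e F * (\<Sum>k=1..N. walsh F \<omega> k)) / 2 ^ n"
      unfolding sum_divide_distrib [symmetric] sum_distrib_left by (subst sum.swap) simp
    finally show "(\<Sum>F\<in>Pow {..<n}. e F * ((\<Sum>k=1..N. walsh F \<omega> k) / real N)) / 2 ^ n
        = real (card (occurrences w \<omega> N)) / real N"
      by (simp add: sum_divide_distrib [symmetric])
  qed
  finally show "(\<lambda>N. real (card (occurrences w \<omega> N)) / real N) \<longlonglongrightarrow> 1 / 2 ^ length w"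
    by (simp add: n_def)
qed

lemma normal_average_tendsto_half:
  assumes "\<omega> \<in> normal_seqs"
  shows "(\<lambda>N. (\<Sum>k=1..N. real (\<omega> k)) / real N) \<longlonglongrightarrow> 1 / 2"
proof -
  have "(\<lambda>N. 1 / 2 - (\<Sum>k=1..N. walsh {0} \<omega> k) / real N / 2) \<longlonglongrightarrow> 1 / 2 - 0 / 2"
    using assms by (intro tendsto_intros walsh_average_tendsto_0_if_normal) auto
  moreover have "eventually (\<lambda>N. 1 / 2 - (\<Sum>k=1..N. walsh {0} \<omega> k) / real N / 2
      = (\<Sum>k=1..N. real (\<omega> k)) / real N) sequentially"
    using eventually_gt_at_top [of 0]
    by eventually_elim (simp add: walsh_def sum_subtractf sum_distrib_left [symmetric]
        sum_distrib_right [symmetric] field_simps)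
  ultimately show ?thesis by (simp add: tendsto_cong)
qed

text \<open>
  Van der Corput's trick: the sum over even positions is compared with the sum of its \<open>L\<close> shifts,
  whose square is bounded on \<^emph>\<open>all\<close> positions, where the pair correlations vanish.
\<close>

lemma normal_even_sign_average_tendsto_0:
  assumes nrm: "\<omega> \<in> normal_seqs"
  shows "(\<lambda>n. (\<Sum>k=1..n. 1 - 2 * real (\<omega> (2 * k))) / real n) \<longlonglongrightarrow> 0"
proof -
  define \<sigma> where "\<sigma> k = 1 - 2 * real (\<omega> k)" for k
  define S where "S n = (\<Sum>k=1..n. \<sigma> (2 * k))" for n
  have bin: "\<omega> \<in> bin_seqs" using nrm by (simp add: normal_seqs_def)
  have \<sigma>: "\<sigma> k = 1 \<or> \<sigma> k = - 1" if "k \<ge> 1" for k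
    using bin_seqs_values [OF bin that] by (auto simp: \<sigma>_def)
  have bound: "eventually (\<lambda>n. (S n / real n)\<^sup>2 \<le> 5 / real L) sequentially" if L: "L \<ge> 1" for L
  proof -
    define f where "f m = (\<Sum>j<L. \<sigma> (m + 2 * j))" for m
    \<comment> \<open>Advancing the shift by one changes only the two boundary terms of the sum,
      each of absolute value 1.\<close>
    have shift: "\<bar>(\<Sum>k=1..n. \<sigma> (2 * k + 2 * j)) - S n\<bar> \<le> 2 * real j" for n j
    proof (induction j)
      case (Suc j)
      have "(\<Sum>k=1..n. \<sigma> (2 * k + 2 * Suc j)) = (\<Sum>k=1..n. \<sigma> (2 * Suc k + 2 * j))"
        by (simp add: algebra_simps)
      also have "\<dots> = (\<Sum>k=1..n. \<sigma> (2 * k + 2 * j)) + (\<sigma> (2 * Suc n + 2 * j) - \<sigma> (2 + 2 * j))"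
        by (induction n) (simp_all add: algebra_simps)
      finally show ?case
        using Suc.IH \<sigma> [of "2 * Suc n + 2 * j"] \<sigma> [of "2 + 2 * j"] by auto
    qed (simp add: S_def)
    \<comment> \<open>\<open>R\<close>, the sum of \<open>f\<close> over even positions, stays
      within \<open>2 * L^2\<close> of \<open>L * S n\<close>. Cauchy-Schwarz bounds
      \<open>R^2\<close>, and including the odd positions only enlarges the sum of squares. The
      factor 4 is 2 from splitting the square and 2 from averaging over \<open>2 * n\<close>
      positions.\<close>
    have ineq: "(S n / real n)\<^sup>2 \<le> 4 * ((\<Sum>m=1..2*n. (f m)\<^sup>2) / real (2 * n)) / (real L)\<^sup>2 + 8 * (real L)\<^sup>2 / (real n)\<^sup>2"
      if n: "n > 0" for n
    proof -
      define R where "R = (\<Sum>k=1..n. f (2 * k))"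
      have "R = (\<Sum>j<L. \<Sum>k=1..n. \<sigma> (2 * k + 2 * j))"
        unfolding R_def f_def by (rule sum.swap)
      then have "R - real L * S n = (\<Sum>j<L. (\<Sum>k=1..n. \<sigma> (2 * k + 2 * j)) - S n)"
        by (simp add: sum_subtractf)
      then have "\<bar>R - real L * S n\<bar> \<le> (\<Sum>j<L. \<bar>(\<Sum>k=1..n. \<sigma> (2 * k + 2 * j)) - S n\<bar>)"
        by (simp only: sum_abs)
      also have "\<dots> \<le> (\<Sum>j<L. 2 * real L)"
        by (intro sum_mono order_trans [OF shift]) auto
      finally have 1: "\<bar>R - real L * S n\<bar> \<le> 2 * (real L)\<^sup>2" by (simp add: power2_eq_square)
      have "R\<^sup>2 \<le> real n * (\<Sum>k=1..n. (f (2 * k))\<^sup>2)"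
        using sum_squared_le_sum_of_squares [of "\<lambda>k. f (2 * k)" "{1..n}"] unfolding R_def by (simp add: mult.commute)
      also have "(\<Sum>k=1..n. (f (2 * k))\<^sup>2) = (\<Sum>m\<in>(\<lambda>k. 2 * k) ` {1..n}. (f m)\<^sup>2)"
        by (subst sum.reindex) (auto simp: inj_on_def)
      also have "\<dots> \<le> (\<Sum>m=1..2*n. (f m)\<^sup>2)"
        by (rule sum_mono2) auto
      finally have 2: "R\<^sup>2 \<le> real n * (\<Sum>m=1..2*n. (f m)\<^sup>2)" by (simp add: mult_left_mono)
      have "(real L * S n)\<^sup>2 \<le> 2 * R\<^sup>2 + 2 * (R - real L * S n)\<^sup>2"
        using zero_le_power2 [of "2 * R - real L * S n"] by (simp add: power2_eq_square algebra_simps)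
      also have "(R - real L * S n)\<^sup>2 \<le> (2 * (real L)\<^sup>2)\<^sup>2"
        using power_mono [OF 1, of 2] by simp
      finally have "(real L)\<^sup>2 * (S n)\<^sup>2 \<le> 2 * (real n * (\<Sum>m=1..2*n. (f m)\<^sup>2)) + 8 * (real L) ^ 4"
        using 2 by (simp add: power_mult_distrib)
      then have "(S n)\<^sup>2 \<le> (2 * (real n * (\<Sum>m=1..2*n. (f m)\<^sup>2)) + 8 * (real L) ^ 4) / (real L)\<^sup>2"
        using L by (simp add: pos_le_divide_eq mult.commute)
      then have "(S n)\<^sup>2 / (real n)\<^sup>2
          \<le> (2 * (real n * (\<Sum>m=1..2*n. (f m)\<^sup>2)) + 8 * (real L) ^ 4) / (real L)\<^sup>2 / (real n)\<^sup>2"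
        by (rule divide_right_mono) simp
      also have "\<dots> = 4 * ((\<Sum>m=1..2*n. (f m)\<^sup>2) / real (2 * n)) / (real L)\<^sup>2 + 8 * (real L)\<^sup>2 / (real n)\<^sup>2"
        using L n by (simp add: field_simps eval_nat_numeral)
      finally show ?thesis by (simp add: power_divide)
    qed
    \<comment> \<open>Off the diagonal the product is the Walsh character with offsets
      \<open>{2 * i, 2 * j}\<close>, so normality makes its average vanish.\<close>
    have corr: "(\<lambda>N. (\<Sum>m=1..N. \<sigma> (m + 2 * i) * \<sigma> (m + 2 * j)) / real N) \<longlonglongrightarrow> (if i = j then 1 else 0)" for i j
    proof (cases "i = j")
      case True
      have "eventually (\<lambda>N. (\<Sum>m=1..N. \<sigma> (m + 2 * i) * \<sigma> (m + 2 * j)) / real N = 1) sequentially"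
        using eventually_gt_at_top [of 0]
      proof eventually_elim
        case (elim N)
        have "(\<Sum>m=1..N. \<sigma> (m + 2 * i) * \<sigma> (m + 2 * j)) = (\<Sum>m=1..N. 1)"
        proof (rule sum.cong)
          fix m assume "m \<in> {1..N}"
          then show "\<sigma> (m + 2 * i) * \<sigma> (m + 2 * j) = 1" using True \<sigma> [of "m + 2 * j"] by auto
        qed simp
        with elim show ?case by simp
      qed
      then show ?thesis using True by (simp add: tendsto_eventually)
    next
      case False
      then have "walsh {2 * i, 2 * j} \<omega> m = \<sigma> (m + 2 * i) * \<sigma> (m + 2 * j)" for m
        by (simp add: walsh_def \<sigma>_def)
      then show ?thesis using False walsh_average_tendsto_0_if_normal [OF nrm, of "{2 * i, 2 * j}"] by simp
    qed
    have "(\<lambda>N. \<Sum>i<L. \<Sum>j<L. (\<Sum>m=1..N. \<sigma> (m + 2 * i) * \<sigma> (m + 2 * j)) / real N)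
        \<longlonglongrightarrow> (\<Sum>i<L. \<Sum>j<L. if i = j then 1 else 0)"
      by (intro tendsto_intros corr)
    also have "(\<lambda>N. \<Sum>i<L. \<Sum>j<L. (\<Sum>m=1..N. \<sigma> (m + 2 * i) * \<sigma> (m + 2 * j)) / real N)
        = (\<lambda>N. (\<Sum>m=1..N. (f m)\<^sup>2) / real N)"
    proof
      fix N
      have "(\<Sum>m=1..N. (f m)\<^sup>2) = (\<Sum>m=1..N. \<Sum>i<L. \<Sum>j<L. \<sigma> (m + 2 * i) * \<sigma> (m + 2 * j))"
        by (simp add: f_def power2_eq_square sum_product)
      also have "\<dots> = (\<Sum>i<L. \<Sum>m=1..N. \<Sum>j<L. \<sigma> (m + 2 * i) * \<sigma> (m + 2 * j))"
        by (rule sum.swap)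
      also have "\<dots> = (\<Sum>i<L. \<Sum>j<L. \<Sum>m=1..N. \<sigma> (m + 2 * i) * \<sigma> (m + 2 * j))"
        by (intro sum.cong refl sum.swap)
      finally show "(\<Sum>i<L. \<Sum>j<L. (\<Sum>m=1..N. \<sigma> (m + 2 * i) * \<sigma> (m + 2 * j)) / real N)
          = (\<Sum>m=1..N. (f m)\<^sup>2) / real N"
        by (simp add: sum_divide_distrib [symmetric])
    qed
    also have "(\<Sum>i<L. \<Sum>j<L. if i = j then 1 else 0) = real L" by simp
    finally have "(\<lambda>N. (\<Sum>m=1..N. (f m)\<^sup>2) / real N) \<longlonglongrightarrow> real L" .
    then have "((\<lambda>N. (\<Sum>m=1..N. (f m)\<^sup>2) / real N) \<circ> (\<lambda>n. 2 * n)) \<longlonglongrightarrow> real L"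
      by (rule LIMSEQ_subseq_LIMSEQ) (auto simp: strict_mono_def)
    then have lim: "(\<lambda>n. (\<Sum>m=1..2*n. (f m)\<^sup>2) / real (2 * n)) \<longlonglongrightarrow> real L"
      by (simp add: o_def)
    have "(\<lambda>n. 4 * ((\<Sum>m=1..2*n. (f m)\<^sup>2) / real (2 * n)) / (real L)\<^sup>2 + 8 * (real L)\<^sup>2 * (1 / real n)\<^sup>2)
        \<longlonglongrightarrow> 4 * real L / (real L)\<^sup>2 + 8 * (real L)\<^sup>2 * 0\<^sup>2"
      using L by (intro tendsto_intros lim lim_1_over_n) auto
    \<comment> \<open>The limit is \<open>4 / L\<close>; the constant 5 gives strict room, so that
      the bound holds eventually.\<close>
    moreover have "4 * real L / (real L)\<^sup>2 + 8 * (real L)\<^sup>2 * 0\<^sup>2 < 5 / real L"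
      using L by (simp add: field_simps power2_eq_square)
    ultimately have "eventually (\<lambda>n. 4 * ((\<Sum>m=1..2*n. (f m)\<^sup>2) / real (2 * n)) / (real L)\<^sup>2
        + 8 * (real L)\<^sup>2 * (1 / real n)\<^sup>2 < 5 / real L) sequentially"
      by (rule order_tendstoD)
    then show ?thesis
      using eventually_gt_at_top [of 0]
    proof eventually_elim
      case (elim n)
      then show ?case using ineq [of n] by (simp add: power_divide)
    qed
  qed
  have "(\<lambda>n. (S n / real n)\<^sup>2) \<longlonglongrightarrow> 0"
  proof (rule order_tendstoI)
    fix a :: real assume "0 < a"
    then obtain L :: nat where L: "5 / a < real L" using reals_Archimedean2 by blast
    with \<open>0 < a\<close> have "0 < 5 / a" by simp
    with L have "real L > 0" by linarith
    with L \<open>0 < a\<close> have "L \<ge> 1" "5 / real L < a" by (auto simp: field_simps)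
    then show "eventually (\<lambda>n. (S n / real n)\<^sup>2 < a) sequentially"
      using bound [of L] by (auto elim!: eventually_mono)
  next
    fix a :: real assume "a < 0"
    then show "eventually (\<lambda>n. a < (S n / real n)\<^sup>2) sequentially"
      by (auto intro!: always_eventually less_le_trans [OF \<open>a < 0\<close>])
  qed
  then have "(\<lambda>n. sqrt ((S n / real n)\<^sup>2)) \<longlonglongrightarrow> sqrt 0" by (rule tendsto_real_sqrt)
  then have "(\<lambda>n. S n / real n) \<longlonglongrightarrow> 0"
    by (simp only: real_sqrt_abs real_sqrt_zero tendsto_rabs_zero_iff)
  then show ?thesis by (simp add: S_def \<sigma>_def)
qed

lemma normal_even_average_tendsto_half:
  assumes "\<omega> \<in> normal_seqs"
  shows "(\<lambda>N. (\<Sum>k=1..N. real (\<omega> (2 * k))) / real N) \<longlonglongrightarrow> 1 / 2"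
proof -
  have "(\<lambda>N. 1 / 2 - (\<Sum>k=1..N. 1 - 2 * real (\<omega> (2 * k))) / real N / 2) \<longlonglongrightarrow> 1 / 2 - 0 / 2"
    using assms by (intro tendsto_intros normal_even_sign_average_tendsto_0) auto
  moreover have "eventually (\<lambda>N. 1 / 2 - (\<Sum>k=1..N. 1 - 2 * real (\<omega> (2 * k))) / real N / 2
      = (\<Sum>k=1..N. real (\<omega> (2 * k))) / real N) sequentially"
    using eventually_gt_at_top [of 0]
    by eventually_elim (simp add: sum_subtractf sum_distrib_left [symmetric]
        sum_distrib_right [symmetric] field_simps)
  ultimately show ?thesis by (simp add: tendsto_cong)
qed

section \<open>A strong law for weakly correlated bounded variables\<close>

text \<open>Going from \<open>n\<close> to \<open>n + 1\<close> adds at most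
  \<open>C * sqrt (n + 1)\<close> nonzero cross terms, each counted twice and at most 1, and a
  diagonal term that is at most 1. Hence the growth is of order n^(3/2).\<close>

lemma (in prob_space) square_sum_expectation_bound:
  fixes X :: "nat \<Rightarrow> 'a \<Rightarrow> real"
  assumes [measurable]: "\<And>k. X k \<in> borel_measurable M"
    and X: "\<And>k x. \<bar>X k x\<bar> \<le> 1"
    and corr: "\<And>l. l \<ge> 1 \<Longrightarrow>
      real (card {k \<in> {1..<l}. expectation (\<lambda>x. X k x * X l x) \<noteq> 0}) \<le> C * sqrt (real l)"
  shows "expectation (\<lambda>x. (\<Sum>k=1..n. X k x)\<^sup>2) \<le> (1 + 2 * C) * (real n * sqrt (real n))"
proof (induction n)
  case (Suc n)
  have XX: "\<bar>X k x * X l x\<bar> \<le> 1" for k l x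
    using mult_mono [OF X [of k x] X [of l x]] by (simp add: abs_mult)
  have int [simp]: "integrable M (\<lambda>x. X k x * X l x)" for k l
    by (rule integrable_const_bound [where B = 1]) (use XX in auto)
  have exp1: "\<bar>expectation (\<lambda>x. X k x * X l x)\<bar> \<le> 1" for k l
  proof -
    have "\<bar>expectation (\<lambda>x. X k x * X l x)\<bar> \<le> expectation (\<lambda>x. \<bar>X k x * X l x\<bar>)"
      using integral_abs_bound by blast
    also have "\<dots> \<le> 1" by (rule integral_le_const) (use XX in auto)
    finally show ?thesis .
  qed
  \<comment> \<open>At \<open>l = 1\<close> the set of correlated indices is empty, so the
    hypothesis says \<open>0 \<le> C\<close>.\<close>
  have "1 \<le> 1 + 2 * C"
    using corr [of 1] by simp
  have "(\<Sum>k=1..Suc n. X k x)\<^sup>2 = (\<Sum>k=1..n. X k x)\<^sup>2 + 2 * (\<Sum>k=1..n. X k x * X (Suc n) x) + X (Suc n) x * X (Suc n) x" for x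
    by (simp add: power2_eq_square algebra_simps sum_distrib_left sum_distrib_right)
  then have "expectation (\<lambda>x. (\<Sum>k=1..Suc n. X k x)\<^sup>2)
      = expectation (\<lambda>x. (\<Sum>k=1..n. X k x)\<^sup>2 + 2 * (\<Sum>k=1..n. X k x * X (Suc n) x) + X (Suc n) x * X (Suc n) x)"
    by simp
  also have "\<dots> = expectation (\<lambda>x. (\<Sum>k=1..n. X k x)\<^sup>2)
      + 2 * (\<Sum>k=1..n. expectation (\<lambda>x. X k x * X (Suc n) x)) + expectation (\<lambda>x. X (Suc n) x * X (Suc n) x)"
    by (simp add: power2_eq_square sum_product)
  also have "(\<Sum>k=1..n. expectation (\<lambda>x. X k x * X (Suc n) x))
      = (\<Sum>k\<in>{k \<in> {1..<Suc n}. expectation (\<lambda>x. X k x * X (Suc n) x) \<noteq> 0}. expectation (\<lambda>x. X k x * X (Suc n) x))"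
    by (rule sum.mono_neutral_right) auto
  also have "\<dots> \<le> real (card {k \<in> {1..<Suc n}. expectation (\<lambda>x. X k x * X (Suc n) x) \<noteq> 0}) * 1"
    by (rule sum_bounded_above) (use exp1 in \<open>auto simp: abs_le_iff\<close>)
  also have "\<dots> \<le> C * sqrt (real (Suc n))" using corr [of "Suc n"] by simp
  also have "expectation (\<lambda>x. X (Suc n) x * X (Suc n) x) \<le> sqrt (real (Suc n))"
    using exp1 [of "Suc n" "Suc n"] by (auto simp: abs_le_iff intro: order_trans)
  also have "expectation (\<lambda>x. (\<Sum>k=1..n. X k x)\<^sup>2) \<le> (1 + 2 * C) * (real n * sqrt (real (Suc n)))"
    using \<open>1 \<le> 1 + 2 * C\<close> by (intro order_trans [OF Suc.IH] mult_left_mono) auto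
  finally show ?case by (simp add: algebra_simps)
qed simp

text \<open>Along \<open>n = m ^ 4\<close> the second moments of the averages are summable, and the gaps are \<open>o(n)\<close>.\<close>

lemma (in prob_space) AE_average_tendsto_0:
  fixes X :: "nat \<Rightarrow> 'a \<Rightarrow> real"
  assumes [measurable]: "\<And>k. X k \<in> borel_measurable M"
    and X: "\<And>k x. \<bar>X k x\<bar> \<le> 1"
    and corr: "\<And>l. l \<ge> 1 \<Longrightarrow>
      real (card {k \<in> {1..<l}. expectation (\<lambda>x. X k x * X l x) \<noteq> 0}) \<le> C * sqrt (real l)"
  shows "AE x in M. (\<lambda>n. (\<Sum>k=1..n. X k x) / real n) \<longlonglongrightarrow> 0"
proof -
  define S where "S n x = (\<Sum>k=1..n. X k x)" for n x
  have [measurable]: "S n \<in> borel_measurable M" for n unfolding S_def by measurable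
  have S: "\<bar>S n x\<bar> \<le> real n" for n x
    using sum_bounded_above [of "{1..n}" "\<lambda>k. \<bar>X k x\<bar>" 1] X unfolding S_def
    by (intro order_trans [OF sum_abs]) simp
  have C: "C \<ge> 0" using corr [of 1] by simp
  define Q where "Q m x = (S (Suc m ^ 4) x / real (Suc m ^ 4))\<^sup>2" for m x
  have [measurable]: "Q m \<in> borel_measurable M" for m unfolding Q_def by measurable
  have intQ: "integrable M (Q m)" for m
  proof (rule integrable_const_bound [where B = 1])
    show "AE x in M. norm (Q m x) \<le> 1"
      using S [of "Suc m ^ 4"] by (auto simp: Q_def abs_square_le_1 abs_divide divide_le_eq)
  qed simp
  \<comment> \<open>With N = (m+1)^4 the bound N^(3/2) / N^2 becomes 1 / (m+1)^2, which is
    summable.\<close>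
  have Q: "expectation (Q m) \<le> (1 + 2 * C) * (1 / (real (Suc m))\<^sup>2)" for m
  proof -
    define N where "N = Suc m ^ 4"
    have sq: "sqrt (real N) = (real (Suc m))\<^sup>2"
      by (rule real_sqrt_unique) (simp_all add: N_def flip: power_mult)
    have "Q m = (\<lambda>x. (S N x)\<^sup>2 / (real N)\<^sup>2)"
      unfolding Q_def N_def power_divide ..
    then have "expectation (Q m) = expectation (\<lambda>x. (S N x)\<^sup>2) / (real N)\<^sup>2" by simp
    also have "\<dots> \<le> ((1 + 2 * C) * (real N * sqrt (real N))) / (real N)\<^sup>2"
      unfolding S_def by (intro divide_right_mono square_sum_expectation_bound assms) auto
    also have "\<dots> = (1 + 2 * C) * (1 / (real (Suc m))\<^sup>2)"
    proof -
      have "real N = ((real (Suc m))\<^sup>2)\<^sup>2" by (simp add: N_def flip: power_mult)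
      moreover have "(real (Suc m))\<^sup>2 > 0" by simp
      ultimately show ?thesis unfolding sq by (simp add: power2_eq_square divide_simps del: of_nat_Suc)
    qed
    finally show ?thesis .
  qed
  have summ: "summable (\<lambda>m. (1 + 2 * C) * (1 / (real (Suc m))\<^sup>2))"
    using inverse_power_summable [of 2, where 'a = real]
    by (intro summable_mult) (subst summable_Suc_iff, simp add: inverse_eq_divide)
  have "(\<integral>\<^sup>+x. (\<Sum>m. ennreal (Q m x)) \<partial>M) = (\<Sum>m. \<integral>\<^sup>+x. ennreal (Q m x) \<partial>M)"
    by (rule nn_integral_suminf) simp
  also have "\<dots> \<le> (\<Sum>m. ennreal ((1 + 2 * C) * (1 / (real (Suc m))\<^sup>2)))"
  proof (intro suminf_le)
    fix m
    have "(\<integral>\<^sup>+x. ennreal (Q m x) \<partial>M) = ennreal (expectation (Q m))"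
      by (intro nn_integral_eq_integral intQ) (simp add: Q_def)
    then show "(\<integral>\<^sup>+x. ennreal (Q m x) \<partial>M) \<le> ennreal ((1 + 2 * C) * (1 / (real (Suc m))\<^sup>2))"
      using ennreal_leI [OF Q] by simp
  qed auto
  also have "\<dots> < \<infinity>"
    using C summ by (subst suminf_ennreal2) (auto simp del: of_nat_Suc)
  finally have "AE x in M. (\<Sum>m. ennreal (Q m x)) \<noteq> \<infinity>"
    by (intro nn_integral_noteq_infinite) auto
  then show ?thesis
  proof (eventually_elim)
    case (elim x)
    then have "summable (\<lambda>m. Q m x)"
      by (intro summable_suminf_not_top) (auto simp: Q_def)
    then have "(\<lambda>m. Q m x) \<longlonglongrightarrow> 0" by (rule summable_LIMSEQ_zero)
    then have "(\<lambda>m. sqrt (Q m x)) \<longlonglongrightarrow> sqrt 0" by (rule tendsto_real_sqrt)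
    then have lim1: "(\<lambda>m. \<bar>S (Suc m ^ 4) x / real (Suc m ^ 4)\<bar>) \<longlonglongrightarrow> 0"
      by (simp add: Q_def)
    \<comment> \<open>This is the relative length of the gap between consecutive fourth powers; it
      bounds the contribution of the terms inside the gap.\<close>
    have lim2: "(\<lambda>m. (1 + 1 / real (Suc m)) ^ 4 - 1) \<longlonglongrightarrow> (1 + 0) ^ 4 - 1"
      by (intro tendsto_intros LIMSEQ_Suc [OF lim_1_over_n])
    have lim: "(\<lambda>m. \<bar>S (Suc m ^ 4) x / real (Suc m ^ 4)\<bar> + ((1 + 1 / real (Suc m)) ^ 4 - 1)) \<longlonglongrightarrow> 0"
      using tendsto_add [OF lim1 lim2] by simp
    show ?case
    proof (rule LIMSEQ_I)
      fix e :: real assume "0 < e"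
      with lim obtain m0 where m0: "\<And>m. m \<ge> m0 \<Longrightarrow>
          \<bar>S (Suc m ^ 4) x / real (Suc m ^ 4)\<bar> + ((1 + 1 / real (Suc m)) ^ 4 - 1) < e"
        by (force dest!: LIMSEQ_D [of _ _ e] simp: abs_less_iff)
      have "norm ((\<Sum>k=1..n. X k x) / real n - 0) < e" if n: "n \<ge> Suc m0 ^ 4" for n
      proof -
        have "\<exists>m\<ge>m0. Suc m ^ 4 \<le> n \<and> n < Suc (Suc m) ^ 4"
        proof -
          \<comment> \<open>The least \<open>m\<close> with \<open>P m\<close> brackets
            \<open>n\<close> between consecutive fourth powers: minimality gives the lower bound, or
            the choice of \<open>n\<close> does when \<open>m = m0\<close>.\<close>
          define P where "P m \<longleftrightarrow> n < Suc (Suc m) ^ 4 \<and> m \<ge> m0" for m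
          have "n < Suc (Suc (n + m0)) ^ 4"
            by (rule less_le_trans [OF _ self_le_power]) auto
          then have "P (n + m0)" by (simp add: P_def)
          define m where "m = (LEAST m. P m)"
          have "P m" unfolding m_def using \<open>P (n + m0)\<close> by (rule LeastI)
          moreover have "Suc m ^ 4 \<le> n"
          proof (cases "m = m0")
            case False
            then have "m > m0" using \<open>P m\<close> by (simp add: P_def)
            then have "m - 1 < m" by simp
            then have "\<not> P (m - 1)" unfolding m_def by (rule not_less_Least)
            then show ?thesis using \<open>m > m0\<close> by (auto simp: P_def not_less)
          qed (use n in simp)
          ultimately show ?thesis by (auto simp: P_def)
        qed
        then obtain m where m: "m \<ge> m0" "Suc m ^ 4 \<le> n" "n < Suc (Suc m) ^ 4" by blast
        define N where "N = Suc m ^ 4"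
        have N: "N > 0" "N \<le> n" using m by (auto simp: N_def)
        have "S n x = S N x + (\<Sum>k\<in>{N<..n}. X k x)"
          unfolding S_def using N by (subst sum.union_disjoint [symmetric]) (auto intro!: sum.cong)
        moreover have "\<bar>\<Sum>k\<in>{N<..n}. X k x\<bar> \<le> real (n - N)"
          using sum_bounded_above [of "{N<..n}" "\<lambda>k. \<bar>X k x\<bar>" 1] X
          by (intro order_trans [OF sum_abs]) simp
        ultimately have "\<bar>S n x\<bar> \<le> \<bar>S N x\<bar> + (real n - real N)" using N by simp
        also have "\<dots> \<le> \<bar>S N x\<bar> + (real (Suc (Suc m) ^ 4) - real N)"
          using m(3) by (intro add_left_mono diff_right_mono) (simp only: of_nat_le_iff)
        finally have "\<bar>S n x\<bar> / real n \<le> (\<bar>S N x\<bar> + (real (Suc (Suc m) ^ 4) - real N)) / real N"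
          using N by (intro frac_le) auto
        also have "\<dots> = \<bar>S N x / real N\<bar> + (real (Suc (Suc m) ^ 4) / real N - 1)"
          using N by (simp add: field_simps abs_divide)
        also have "real (Suc (Suc m) ^ 4) / real N = (1 + 1 / real (Suc m)) ^ 4"
          by (simp add: N_def field_simps flip: power_divide)
        finally have "\<bar>S n x\<bar> / real n < e" using m0 [OF m(1)] unfolding N_def by linarith
        then show ?thesis by (simp add: S_def abs_divide)
      qed
      then show "\<exists>no. \<forall>n\<ge>no. norm ((\<Sum>k=1..n. X k x) / real n - 0) < e" by blast
    qed
  qed
qed

section \<open>Dyadic chains and the upper bound\<close>

text \<open>
  The letters at the positions \<open>i, 2i, 4i, \<dots>\<close> (\<open>i\<close> odd) form a chain: \<open>\<eta> i\<close> is its first letter,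
  and \<open>\<eta> (2 * k)\<close> tells whether the letters at \<open>k\<close> and \<open>2 * k\<close> differ.
\<close>

fun chain_seq :: "(nat \<Rightarrow> bool) \<Rightarrow> nat \<Rightarrow> nat" where
  "chain_seq \<eta> m = (if m = 0 then undefined else if odd m then of_bool (\<eta> m)
     else if \<eta> m then 1 - chain_seq \<eta> (m div 2) else chain_seq \<eta> (m div 2))"

declare chain_seq.simps [simp del]

text \<open>The inverse of \<open>chain_seq\<close> at positive indices, recovering first letters
  and mismatches.\<close>

definition chain_code :: "(nat \<Rightarrow> nat) \<Rightarrow> nat \<Rightarrow> bool" where
  "chain_code \<omega> m = (if odd m then \<omega> m = 1 else \<omega> m \<noteq> \<omega> (m div 2))"

lemma chain_seq_odd: "odd m \<Longrightarrow> chain_seq \<eta> m = of_bool (\<eta> m)"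
  by (subst chain_seq.simps) (auto elim: oddE)

lemma chain_seq_even:
  "even m \<Longrightarrow> m > 0 \<Longrightarrow> chain_seq \<eta> m = (if \<eta> m then 1 - chain_seq \<eta> (m div 2) else chain_seq \<eta> (m div 2))"
  by (subst chain_seq.simps) simp

lemma chain_seq_double:
  "k \<ge> 1 \<Longrightarrow> chain_seq \<eta> (2 * k) = (if \<eta> (2 * k) then 1 - chain_seq \<eta> k else chain_seq \<eta> k)"
  by (subst chain_seq_even) auto

lemma chain_seq_le_1: "m > 0 \<Longrightarrow> chain_seq \<eta> m \<le> 1"
proof (induction m rule: less_induct)
  case (less m)
  then show ?case
    by (cases "odd m") (auto simp: chain_seq_odd chain_seq_even elim!: evenE)
qed

lemma chain_seq_in_bin_seqs: "chain_seq \<eta> \<in> bin_seqs"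
proof -
  have "chain_seq \<eta> m = 0 \<or> chain_seq \<eta> m = 1" if "m \<ge> 1" for m
    using chain_seq_le_1 [of m \<eta>] that by linarith
  moreover have "chain_seq \<eta> 0 = undefined" by (subst chain_seq.simps) simp
  ultimately show ?thesis
    unfolding bin_seqs_def by (auto simp: PiE_iff extensional_def not_less_eq_eq)
qed

lemma chain_code_chain_seq:
  assumes "m \<ge> 1"
  shows "chain_code (chain_seq \<eta>) m = \<eta> m"
proof (cases "odd m")
  case False
  then have "m div 2 > 0" using assms by (auto elim!: evenE)
  then show ?thesis
    using False assms chain_seq_le_1 [of "m div 2" \<eta>]
    by (cases "chain_seq \<eta> (m div 2) = 0") (auto simp: chain_code_def chain_seq_even)
qed (simp add: chain_code_def chain_seq_odd)

text \<open>Halving an index in \<open>{1..n}\<close> stays in \<open>{1..n}\<close>, so the change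
  of coordinates is triangular. With the converse \<open>chain_code_cong\<close>, cylinders of order
  \<open>n\<close> for letters and for coins correspond.\<close>

lemma chain_seq_cong:
  assumes "\<And>i. i \<in> {1..n} \<Longrightarrow> \<eta> i = \<eta>' i" "m \<in> {1..n}"
  shows "chain_seq \<eta> m = chain_seq \<eta>' m"
  using assms(2)
proof (induction m rule: less_induct)
  case (less m)
  then show ?case
    by (cases "odd m") (use less.prems in \<open>auto simp: chain_seq_odd chain_seq_even assms(1) elim!: evenE\<close>)
qed

lemma chain_code_cong:
  assumes "\<And>i. i \<in> {1..n} \<Longrightarrow> \<omega> i = \<omega>' i" "m \<in> {1..n}"
  shows "chain_code \<omega> m = chain_code \<omega>' m"
proof (cases "odd m")
  case False
  then have "m div 2 \<in> {1..n}" using assms(2) by (auto elim!: evenE)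
  then show ?thesis using False assms by (simp add: chain_code_def)
qed (use assms in \<open>simp add: chain_code_def\<close>)

lemma chain_seq_chain_code:
  assumes "\<omega> \<in> bin_seqs" "m \<ge> 1"
  shows "chain_seq (chain_code \<omega>) m = \<omega> m"
  using assms(2)
proof (induction m rule: less_induct)
  case (less m)
  show ?case
  proof (cases "odd m")
    case True
    then show ?thesis
      using bin_seqs_values [OF assms(1) less.prems] by (auto simp: chain_seq_odd chain_code_def)
  next
    case False
    then have "m div 2 \<ge> 1" "m div 2 < m" using less.prems by (auto elim!: evenE)
    then show ?thesis
      using False less bin_seqs_values [OF assms(1) less.prems] bin_seqs_values [OF assms(1), of "m div 2"]
      by (auto simp: chain_seq_even chain_code_def)
  qed
qed

section \<open>Coin weights and cross-entropy\<close>

definition coin_prob :: "real \<Rightarrow> nat \<Rightarrow> bool \<Rightarrow> real" where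
  "coin_prob r m b = (if odd m then 1 / 2 else if b then r else 1 - r)"

text \<open>The mass of the cylinder of order \<open>n\<close> around \<eta> when the coins are
  independent. As a finite product it serves the covering argument without any measure
  theory.\<close>

definition coin_weight :: "real \<Rightarrow> nat \<Rightarrow> (nat \<Rightarrow> bool) \<Rightarrow> real" where
  "coin_weight r n \<eta> = (\<Prod>m=1..n. coin_prob r m (\<eta> m))"

lemma sum_odd_even:
  fixes g :: "nat \<Rightarrow> real"
  shows "(\<Sum>m=1..n. if odd m then c else g m) = c * (real n - real (n div 2)) + (\<Sum>k=1..n div 2. g (2 * k))"
proof (induction n)
  case (Suc n)
  show ?case
  proof (cases "even n")
    case True
    then have "Suc n div 2 = n div 2" by (auto elim!: evenE)
    then show ?thesis using Suc True by (simp add: algebra_simps)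
  next
    case False
    then have "Suc n div 2 = Suc (n div 2)" "2 * Suc (n div 2) = Suc n" by (auto elim!: oddE)
    then show ?thesis using Suc False by (simp add: algebra_simps)
  qed
qed simp

lemma half_div_tendsto: "(\<lambda>n. real (n div 2) / real n) \<longlonglongrightarrow> 1 / 2"
proof (rule real_tendsto_sandwich)
  show "(\<lambda>n. 1 / 2 - 1 / real n) \<longlonglongrightarrow> 1 / 2"
    using tendsto_diff [OF tendsto_const [of "1 / 2"] lim_1_over_n] by simp
  have "1 / 2 - 1 / real n \<le> real (n div 2) / real n \<and> real (n div 2) / real n \<le> 1 / 2" if "n > 0" for n
  proof -
    have "real n \<le> 2 * real (n div 2) + 1" "2 * real (n div 2) \<le> real n" by linarith+
    then have "(real n / 2 - 1) / real n \<le> real (n div 2) / real n" "real (n div 2) / real n \<le> (real n / 2) / real n"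
      by (intro divide_right_mono; simp)+
    then show ?thesis using that by (simp add: diff_divide_distrib)
  qed
  then show "eventually (\<lambda>n. 1 / 2 - 1 / real n \<le> real (n div 2) / real n) sequentially"
    and "eventually (\<lambda>n. real (n div 2) / real n \<le> 1 / 2) sequentially"
    by (auto intro!: eventually_mono [OF eventually_gt_at_top [of 0]])
qed simp

text \<open>The information per letter when mismatches of frequency \<open>q\<close> are coded with
  coins of bias \<open>r\<close>. For \<open>r = q\<close> it is the entropy claimed in the
  theorem.\<close>

definition cross_entropy :: "real \<Rightarrow> real \<Rightarrow> real" where
  "cross_entropy q r = 1 / 2 * ln 2 - 1 / 2 * (q * ln r + (1 - q) * ln (1 - r))"

text \<open>Half of the positions are odd and contribute \<open>ln (1 / 2)\<close> each; the other
  \<open>n div 2\<close> coins are \<eta> at 2, 4, ..., whose frequency of heads tends to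
  \<open>q\<close>.\<close>

lemma sum_ln_coin_prob_tendsto:
  assumes "(\<lambda>n. (\<Sum>k=1..n. of_bool (\<eta> (2 * k))) / real n) \<longlonglongrightarrow> q"
  shows "(\<lambda>n. (\<Sum>m=1..n. ln (coin_prob r m (\<eta> m))) / real n) \<longlonglongrightarrow> - cross_entropy q r"
proof -
  define A where "A j = (\<Sum>k=1..j. of_bool (\<eta> (2 * k))) / real j" for j
  define \<rho> where "\<rho> n = real (n div 2) / real n" for n
  have "filterlim (\<lambda>n::nat. n div 2) sequentially sequentially"
    by (rule filterlim_at_top_div_const_nat) simp
  then have A: "(\<lambda>n. A (n div 2)) \<longlonglongrightarrow> q"
    using assms unfolding A_def by (rule filterlim_compose [rotated])
  have "(\<lambda>n. ln (1 / 2) * (1 - \<rho> n) + (A (n div 2) * (ln r - ln (1 - r)) + ln (1 - r)) * \<rho> n)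
      \<longlonglongrightarrow> ln (1 / 2) * (1 - 1 / 2) + (q * (ln r - ln (1 - r)) + ln (1 - r)) * (1 / 2)"
    unfolding \<rho>_def by (intro tendsto_intros A half_div_tendsto)
  also have "ln (1 / 2) * (1 - 1 / 2) + (q * (ln r - ln (1 - r)) + ln (1 - r)) * (1 / 2) = - cross_entropy q r"
    by (simp add: cross_entropy_def ln_div algebra_simps)
  finally have lim: "(\<lambda>n. ln (1 / 2) * (1 - \<rho> n) + (A (n div 2) * (ln r - ln (1 - r)) + ln (1 - r)) * \<rho> n)
      \<longlonglongrightarrow> - cross_entropy q r" .
  have "(\<Sum>m=1..n. ln (coin_prob r m (\<eta> m))) / real n
      = ln (1 / 2) * (1 - \<rho> n) + (A (n div 2) * (ln r - ln (1 - r)) + ln (1 - r)) * \<rho> n" if "n > 0" for n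
  proof -
    define j where "j = n div 2"
    have Aj: "A j * real j = (\<Sum>k=1..j. of_bool (\<eta> (2 * k)))"
      by (cases "j = 0") (simp_all add: A_def)
    have "(\<Sum>m=1..n. ln (coin_prob r m (\<eta> m)))
        = (\<Sum>m=1..n. if odd m then ln (1 / 2) else of_bool (\<eta> m) * (ln r - ln (1 - r)) + ln (1 - r))"
      by (intro sum.cong) (auto simp: coin_prob_def)
    also have "\<dots> = ln (1 / 2) * (real n - real j)
        + (\<Sum>k=1..j. of_bool (\<eta> (2 * k)) * (ln r - ln (1 - r)) + ln (1 - r))"
      by (subst sum_odd_even) (simp add: j_def)
    also have "\<dots> = ln (1 / 2) * (real n - real j) + (A j * (ln r - ln (1 - r)) + ln (1 - r)) * real j"
      unfolding sum.distrib sum_distrib_right [symmetric] Aj [symmetric] by (simp add: algebra_simps)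
    finally have eq: "(\<Sum>m=1..n. ln (coin_prob r m (\<eta> m)))
        = ln (1 / 2) * (real n - real j) + (A j * (ln r - ln (1 - r)) + ln (1 - r)) * real j" .
    show ?thesis unfolding eq \<rho>_def j_def [symmetric]
      using that by (simp add: add_divide_distrib diff_divide_distrib right_diff_distrib)
  qed
  then have "eventually (\<lambda>n. (\<Sum>m=1..n. ln (coin_prob r m (\<eta> m))) / real n
      = ln (1 / 2) * (1 - \<rho> n) + (A (n div 2) * (ln r - ln (1 - r)) + ln (1 - r)) * \<rho> n) sequentially"
    using eventually_gt_at_top [of 0] by (rule eventually_mono [rotated])
  then show ?thesis using lim by (simp add: tendsto_cong)
qed

text \<open>The sum factors over the letters, each factor being a total probability. Lists are
  indexed from 0 and coins from 1, hence \<open>m - 1\<close>.\<close>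

lemma sum_coin_weight_lists:
  "(\<Sum>w | length w = n. coin_weight r n (\<lambda>m. w ! (m - 1))) = 1"
proof -
  have "coin_weight r n (\<lambda>m. w ! (m - 1)) = (\<Prod>i<n. coin_prob r (Suc i) (w ! i))" for w
    unfolding coin_weight_def by (simp add: prod.atLeast1_atMost_eq)
  then have "(\<Sum>w | length w = n. coin_weight r n (\<lambda>m. w ! (m - 1)))
      = (\<Sum>w | length w = n \<and> set w \<subseteq> UNIV. \<Prod>i<n. coin_prob r (Suc i) (w ! i))" by simp
  also have "\<dots> = (\<Prod>i<n. \<Sum>b\<in>UNIV. coin_prob r (Suc i) b)" by (rule sum_lists_prod)
  also have "\<dots> = 1" by (intro prod.neutral) (simp add: UNIV_bool coin_prob_def)
  finally show ?thesis .
qed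

text \<open>Every point of \<open>E\<close> has arbitrarily long prefixes of weight at least exp(-(h
  + \<delta>) n). Cylinders of such heavy words cover \<open>E\<close>. The words of one length have
  total weight 1, so at the exponent h + 2 \<delta> the cover costs at most a geometric series,
  uniformly in \<open>N\<close>.\<close>

lemma h_top_le_cross_entropy:
  assumes E: "E \<subseteq> bin_seqs" and r: "0 < r" "r < 1" and q: "0 \<le> q" "q \<le> 1"
    and lim: "\<And>\<omega>. \<omega> \<in> E \<Longrightarrow> (\<lambda>n. (\<Sum>k=1..n. of_bool (\<omega> (2 * k) \<noteq> \<omega> k)) / real n) \<longlonglongrightarrow> q"
  shows "h_top E \<le> cross_entropy q r"
proof (rule field_le_epsilon)
  fix e :: real assume "e > 0"
  define h where "h = cross_entropy q r"
  \<comment> \<open>Then \<open>s = h + e / 2\<close>, which leaves room to pass from finite measure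
    at \<open>s\<close> to measure zero at \<open>h + e\<close>.\<close>
  define \<delta> where "\<delta> = e / 4"
  define s where "s = h + 2 * \<delta>"
  have \<delta>: "\<delta> > 0" using \<open>e > 0\<close> by (simp add: \<delta>_def)
  \<comment> \<open>Needed at the end, since \<open>h_top\<close> is an infimum over nonnegative
    exponents only.\<close>
  have "h \<ge> 0"
  proof -
    have "q * ln r \<le> 0" "(1 - q) * ln (1 - r) \<le> 0" using r q by (auto simp: mult_nonneg_nonpos)
    moreover have "0 \<le> 1 / 2 * ln 2 - 1 / 2 * (a + b)" if "a \<le> 0" "b \<le> 0" for a b :: real
    proof -
      have "0 \<le> ln (2::real)" by simp
      with that show ?thesis by argo
    qed
    ultimately show ?thesis unfolding h_def cross_entropy_def by blast
  qed
  have prob_pos: "coin_prob r m b > 0" for m b using r by (simp add: coin_prob_def)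
  then have weight_pos: "coin_weight r n \<eta> > 0" for n \<eta> unfolding coin_weight_def by (intro prod_pos) auto
  have ln_weight: "ln (coin_weight r n \<eta>) = (\<Sum>m=1..n. ln (coin_prob r m (\<eta> m)))" for n \<eta>
    unfolding coin_weight_def using prob_pos by (subst ln_prod) (auto simp: less_imp_neq [symmetric])
  define B where "B = 1 / (1 - exp (- \<delta>))"
  have bound: "entropy_premeasure s N E \<le> ennreal B" for N
  proof -
    define f where "f w m = w ! (m - 1)" for w :: "bool list" and m :: nat
    define U where "U = {w. length w \<ge> N \<and> exp (- (h + \<delta>) * real (length w)) \<le> coin_weight r (length w) (f w)}"
    \<comment> \<open>Covers are indexed by sets of naturals, so the heavy words are encoded as
      numbers.\<close>
    define I where "I = to_nat ` U"
    have cover: "E \<subseteq> (\<Union>i\<in>I. cylinder (length (from_nat i :: bool list)) (chain_seq (f (from_nat i))))"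
    proof
      fix \<omega> assume \<omega>: "\<omega> \<in> E"
      then have bin: "\<omega> \<in> bin_seqs" using E by blast
      define \<eta> where "\<eta> = chain_code \<omega>"
      have "(\<lambda>n. (\<Sum>k=1..n. of_bool (\<eta> (2 * k))) / real n) \<longlonglongrightarrow> q"
        using lim [OF \<omega>] by (simp add: \<eta>_def chain_code_def)
      then have "(\<lambda>n. (\<Sum>m=1..n. ln (coin_prob r m (\<eta> m))) / real n) \<longlonglongrightarrow> - h"
        unfolding h_def by (rule sum_ln_coin_prob_tendsto)
      moreover have "- (h + \<delta>) < - h" using \<delta> by simp
      ultimately have "eventually (\<lambda>n. - (h + \<delta>) < (\<Sum>m=1..n. ln (coin_prob r m (\<eta> m))) / real n) sequentially"
        by (rule order_tendstoD)
      then have "eventually (\<lambda>n. - (h + \<delta>) < (\<Sum>m=1..n. ln (coin_prob r m (\<eta> m))) / real n \<and> n \<ge> N \<and> n > 0) sequentially"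
        using eventually_ge_at_top [of N] eventually_gt_at_top [of 0] by eventually_elim auto
      then obtain n where n: "- (h + \<delta>) < (\<Sum>m=1..n. ln (coin_prob r m (\<eta> m))) / real n" "n \<ge> N" "n > 0"
        by (auto dest!: eventually_happens)
      define w where "w = map (\<lambda>i. \<eta> (Suc i)) [0..<n]"
      have len: "length w = n" by (simp add: w_def)
      have fw: "f w m = \<eta> m" if "m \<in> {1..n}" for m
        using that by (cases m) (auto simp: f_def w_def)
      then have "coin_weight r n (f w) = coin_weight r n \<eta>" unfolding coin_weight_def by (intro prod.cong) auto
      moreover have "- (h + \<delta>) * real n \<le> ln (coin_weight r n \<eta>)"
        using n unfolding ln_weight by (simp add: pos_less_divide_eq)
      then have "exp (- (h + \<delta>) * real n) \<le> coin_weight r n \<eta>"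
        using weight_pos by (subst (asm) ln_ge_iff) auto
      ultimately have "w \<in> U" using n by (simp add: U_def len)
      then have "to_nat w \<in> I" by (simp add: I_def)
      moreover have "\<omega> \<in> cylinder n (chain_seq (f w))"
        unfolding cylinder_def
      proof (safe intro!: bin)
        fix m assume "m \<in> {1..n}"
        then have "chain_seq (f w) m = chain_seq \<eta> m" using fw by (intro chain_seq_cong [of n]) auto
        also have "\<dots> = \<omega> m" using \<open>m \<in> {1..n}\<close> bin by (simp add: \<eta>_def chain_seq_chain_code)
        finally show "\<omega> m = chain_seq (f w) m" by simp
      qed
      ultimately show "\<omega> \<in> (\<Union>i\<in>I. cylinder (length (from_nat i :: bool list)) (chain_seq (f (from_nat i))))"
        using len by (intro UN_I [of "to_nat w"]) simp_all
    qed
    have "entropy_premeasure s N E \<le> (\<Sum>\<^sub>\<infinity>i\<in>I. ennreal (exp (- s * real (length (from_nat i :: bool list)))))"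
      by (rule entropy_premeasure_le [OF _ cover]) (auto simp: I_def U_def chain_seq_in_bin_seqs)
    also have "\<dots> = (\<Sum>\<^sub>\<infinity>w\<in>U. ennreal (exp (- s * real (length w))))"
      unfolding I_def by (subst infsum_reindex) (auto simp: inj_on_def o_def)
    also have "\<dots> \<le> ennreal B"
    proof (subst nonneg_infsum_complete, simp, rule SUP_least)
      fix F assume "F \<in> {F. finite F \<and> F \<subseteq> U}"
      then have F: "finite F" "F \<subseteq> U" by auto
      \<comment> \<open>A finite family has bounded word length and is compared with the family of
        all words up to that length.\<close>
      define R where "R = Max (insert 0 (length ` F))"
      have R: "length w \<le> R" if "w \<in> F" for w using F that by (auto simp: R_def intro!: Max_ge)
      have fin: "finite {w::bool list. length w = n}" for n
        using finite_lists_length_eq [of "UNIV :: bool set" n] by simp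
      define g where "g w = exp (- \<delta>) ^ length w * coin_weight r (length w) (f w)" for w
      have "(\<Sum>w\<in>F. exp (- s * real (length w))) \<le> (\<Sum>w\<in>F. g w)"
      proof (rule sum_mono)
        fix w assume "w \<in> F"
        then have "exp (- (h + \<delta>) * real (length w)) \<le> coin_weight r (length w) (f w)" using F by (auto simp: U_def)
        then have "exp (- \<delta> * real (length w)) * exp (- (h + \<delta>) * real (length w)) \<le> g w"
          unfolding g_def exp_of_nat2_mult [of "- \<delta>"] by (rule mult_left_mono) simp
        moreover have "- \<delta> * real (length w) + - (h + \<delta>) * real (length w) = - s * real (length w)"
          by (simp add: s_def algebra_simps)
        ultimately show "exp (- s * real (length w)) \<le> g w" by (simp only: exp_add [symmetric])
      qed
      also have "\<dots> \<le> (\<Sum>w\<in>(\<Union>n\<in>{..R}. {w. length w = n}). g w)"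
        using R fin weight_pos by (intro sum_mono2) (auto simp: g_def less_imp_le)
      also have "\<dots> = (\<Sum>n\<le>R. \<Sum>w | length w = n. g w)"
        using fin by (subst sum.UNION_disjoint) auto
      also have "\<dots> = (\<Sum>n\<le>R. exp (- \<delta>) ^ n * (\<Sum>w | length w = n. coin_weight r n (f w)))"
        unfolding sum_distrib_left by (intro sum.cong refl) (auto simp: g_def)
      also have "\<dots> = (\<Sum>n<Suc R. exp (- \<delta>) ^ n)"
        unfolding f_def sum_coin_weight_lists lessThan_Suc_atMost by simp
      also have "\<dots> \<le> (\<Sum>n. exp (- \<delta>) ^ n)"
        using \<delta> by (intro sum_le_suminf summable_geometric) auto
      also have "\<dots> = B" unfolding B_def using \<delta> by (intro suminf_geometric) auto
      finally show "(\<Sum>w\<in>F. ennreal (exp (- s * real (length w)))) \<le> ennreal B"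
        by (simp add: ennreal_leI)
    qed
    finally show ?thesis .
  qed
  then have "entropy_measure s E \<le> ennreal B"
    unfolding entropy_measure_eq_SUP by (intro SUP_least)
  then have "entropy_measure s E \<noteq> \<infinity>" by (auto simp: top_unique)
  moreover have "s < h + e" using \<open>e > 0\<close> by (simp add: s_def \<delta>_def)
  ultimately have "entropy_measure (h + e) E = 0" by (intro entropy_measure_eq_0 [of s])
  then show "h_top E \<le> cross_entropy q r + e"
    unfolding h_top_def using \<open>h \<ge> 0\<close> \<open>e > 0\<close>
    by (intro cInf_lower bdd_belowI [of _ 0]) (auto simp: h_def)
qed

text \<open>Coding with the true bias is optimal. If \<open>q\<close> is 0 or 1, that bias is not
  allowed in \<open>h_top_le_cross_entropy\<close>, and nearby biases give the bound in the
  limit.\<close>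

lemma h_top_le:
  assumes E: "E \<subseteq> bin_seqs" and q: "0 \<le> q" "q \<le> 1"
    and lim: "\<And>\<omega>. \<omega> \<in> E \<Longrightarrow> (\<lambda>n. (\<Sum>k=1..n. of_bool (\<omega> (2 * k) \<noteq> \<omega> k)) / real n) \<longlonglongrightarrow> q"
  shows "h_top E \<le> 1 / 2 * ln 2 + 1 / 2 * bin_entropy q"
proof -
  have le: "h_top E \<le> cross_entropy q r" if "0 < r" "r < 1" for r
    using h_top_le_cross_entropy [OF E that q lim] .
  show ?thesis
  proof (cases "0 < q \<and> q < 1")
    case True
    then show ?thesis using le [of q] by (simp add: cross_entropy_def bin_entropy_def algebra_simps)
  next
    case False
    then have q: "q = 0 \<or> q = 1" using q by auto
    have "h_top E \<le> 1 / 2 * ln 2 + e" if "e > 0" for e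
    proof -
      \<comment> \<open>Chosen so that \<open>- 1 / 2 * ln x = e\<close>; the bias is
        \<open>x\<close> for \<open>q = 1\<close> and \<open>1 - x\<close> for
        \<open>q = 0\<close>.\<close>
      define x where "x = exp (- 2 * e)"
      have x: "0 < x" "x < 1" "ln x = - 2 * e" using that by (auto simp: x_def)
      show ?thesis using q le [of x] le [of "1 - x"] x by (auto simp: cross_entropy_def)
    qed
    then have "h_top E \<le> 1 / 2 * ln 2" by (rule field_le_epsilon)
    then show ?thesis using q by auto
  qed
qed

section \<open>The coin measure and the lower bound\<close>

definition coin_space :: "real \<Rightarrow> (nat \<Rightarrow> bool) measure" where
  "coin_space q = (\<Pi>\<^sub>M m\<in>UNIV. measure_pmf (bernoulli_pmf (if odd m then 1 / 2 else q)))"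

lemma space_coin_space [simp]: "space (coin_space q) = UNIV"
  by (simp add: coin_space_def space_PiM)

lemma prob_space_coin_space: "prob_space (coin_space q)"
  unfolding coin_space_def by (intro prob_space_PiM prob_space_measure_pmf)

lemma measurable_coin [measurable]: "(\<lambda>\<eta>. \<eta> m) \<in> measurable (coin_space q) (count_space UNIV)"
proof -
  have "(\<lambda>\<eta>. \<eta> m) \<in> measurable (coin_space q) (measure_pmf (bernoulli_pmf (if odd m then 1 / 2 else q)))"
    unfolding coin_space_def by (rule measurable_component_singleton) simp
  then show ?thesis by simp
qed

text \<open>The integrand factors through the restriction to \<open>J\<close>, whose law is the
  finite product measure; there the integral splits.\<close>

lemma integral_PiM_prod:
  fixes f :: "'i \<Rightarrow> 'a \<Rightarrow> real"
  assumes "\<And>i. prob_space (M i)" "finite J" "J \<subseteq> I" "\<And>i. i \<in> J \<Longrightarrow> integrable (M i) (f i)"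
  shows "(\<integral>x. (\<Prod>i\<in>J. f i (x i)) \<partial>PiM I M) = (\<Prod>i\<in>J. integral\<^sup>L (M i) (f i))"
proof -
  interpret product_prob_space M I
    using assms(1) by (rule product_prob_spaceI)
  have [measurable]: "f i \<in> borel_measurable (M i)" if "i \<in> J" for i using assms(4) that by auto
  have "(\<integral>x. (\<Prod>i\<in>J. f i (x i)) \<partial>PiM I M) = (\<integral>x. (\<Prod>i\<in>J. f i (restrict x J i)) \<partial>PiM I M)"
    by (intro Bochner_Integration.integral_cong prod.cong) auto
  also have "\<dots> = (\<integral>x. (\<Prod>i\<in>J. f i (x i)) \<partial>distr (PiM I M) (PiM J M) (\<lambda>x. restrict x J))"
    using assms(3) by (subst integral_distr) (auto intro!: measurable_restrict_subset)
  also have "\<dots> = (\<integral>x. (\<Prod>i\<in>J. f i (x i)) \<partial>PiM J M)"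
    using assms by (subst distr_PiM_restrict_finite) auto
  also have "\<dots> = (\<Prod>i\<in>J. integral\<^sup>L (M i) (f i))"
    using assms by (intro product_integral_prod) auto
  finally show ?thesis .
qed

lemma integral_coin_space_prod:
  fixes f :: "nat \<Rightarrow> bool \<Rightarrow> real"
  assumes "0 \<le> q" "q \<le> 1" "finite J"
  shows "(\<integral>\<eta>. (\<Prod>m\<in>J. f m (\<eta> m)) \<partial>coin_space q)
    = (\<Prod>m\<in>J. coin_prob q m True * f m True + coin_prob q m False * f m False)"
  unfolding coin_space_def
  by (subst integral_PiM_prod)
    (use assms in \<open>auto simp: prob_space_measure_pmf coin_prob_def mult.commute
       intro!: prod.cong integrable_measure_pmf_finite\<close>)

lemma emeasure_coin_cylinder:
  assumes "0 \<le> q" "q \<le> 1"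
  shows "emeasure (coin_space q) {\<eta>. \<forall>m\<in>{1..n}. \<eta> m = \<eta>' m} = ennreal (coin_weight q n \<eta>')"
proof -
  interpret product_prob_space "\<lambda>m. measure_pmf (bernoulli_pmf (if odd m then 1 / 2 else q))" "UNIV :: nat set"
    by (rule product_prob_spaceI) (rule prob_space_measure_pmf)
  have "emeasure (coin_space q) {\<eta>. \<forall>m\<in>{1..n}. \<eta> m = \<eta>' m}
      = (\<Prod>m\<in>{1..n}. emeasure (measure_pmf (bernoulli_pmf (if odd m then 1 / 2 else q))) {\<eta>' m})"
    using emeasure_PiM_Collect [of "{1..n}" "\<lambda>m. {\<eta>' m}"] by (simp add: coin_space_def space_PiM)
  also have "\<dots> = (\<Prod>m\<in>{1..n}. ennreal (coin_prob q m (\<eta>' m)))"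
    using assms by (intro prod.cong refl) (auto simp: emeasure_pmf_single coin_prob_def)
  also have "\<dots> = ennreal (coin_weight q n \<eta>')"
    unfolding coin_weight_def using assms by (intro prod_ennreal) (auto simp: coin_prob_def)
  finally show ?thesis .
qed

text \<open>Centred coins at distinct even positions are uncorrelated, so the strong law above
  applies with \<open>C = 0\<close>.\<close>

lemma AE_coin_average_tendsto:
  assumes q: "0 \<le> q" "q \<le> 1"
  shows "AE \<eta> in coin_space q. (\<lambda>n. (\<Sum>k=1..n. of_bool (\<eta> (2 * k))) / real n) \<longlonglongrightarrow> q"
proof -
  interpret prob_space "coin_space q" by (rule prob_space_coin_space)
  define X where "X k \<eta> = of_bool (\<eta> (2 * k)) - q" for k :: nat and \<eta> :: "nat \<Rightarrow> bool"
  have "expectation (\<lambda>\<eta>. X k \<eta> * X l \<eta>) = 0" if "k \<noteq> l" for k l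
  proof -
    have "expectation (\<lambda>\<eta>. X k \<eta> * X l \<eta>) = expectation (\<lambda>\<eta>. \<Prod>m\<in>{2 * k, 2 * l}. of_bool (\<eta> m) - q)"
      using that by (simp add: X_def)
    also have "\<dots> = 0"
      using that q by (subst integral_coin_space_prod) (auto simp: coin_prob_def algebra_simps)
    finally show ?thesis .
  qed
  then have bad: "{k \<in> {1..<l}. expectation (\<lambda>\<eta>. X k \<eta> * X l \<eta>) \<noteq> 0} = {}" for l by auto
  have "AE \<eta> in coin_space q. (\<lambda>n. (\<Sum>k=1..n. X k \<eta>) / real n) \<longlonglongrightarrow> 0"
  proof (rule AE_average_tendsto_0 [where C = 0])
    show "X k \<in> borel_measurable (coin_space q)" for k unfolding X_def by measurable
    show "\<bar>X k \<eta>\<bar> \<le> 1" for k \<eta> using q by (auto simp: X_def)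
    show "real (card {k \<in> {1..<l}. expectation (\<lambda>\<eta>. X k \<eta> * X l \<eta>) \<noteq> 0}) \<le> 0 * sqrt (real l)" for l
      unfolding bad by simp
  qed
  then show ?thesis
  proof eventually_elim
    case (elim \<eta>)
    then have "(\<lambda>n. (\<Sum>k=1..n. X k \<eta>) / real n + q) \<longlonglongrightarrow> 0 + q" by (intro tendsto_intros)
    moreover have "eventually (\<lambda>n. (\<Sum>k=1..n. X k \<eta>) / real n + q = (\<Sum>k=1..n. of_bool (\<eta> (2 * k))) / real n) sequentially"
      using eventually_gt_at_top [of 0]
      by eventually_elim (simp add: X_def sum_subtractf diff_divide_distrib del: sum_of_bool_eq)
    ultimately show ?case by (simp add: tendsto_cong del: sum_of_bool_eq)
  qed
qed

text \<open>The mass distribution principle for the image of the coin measure under \<open>chain_seq\<close>.\<close>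

lemma h_top_ge:
  assumes E: "E \<subseteq> bin_seqs" and q: "0 \<le> q" "q \<le> 1"
    and AE_E: "AE \<eta> in coin_space q. chain_seq \<eta> \<in> E"
  shows "h_top E \<ge> 1 / 2 * ln 2 + 1 / 2 * bin_entropy q"
proof (rule ccontr)
  interpret prob_space "coin_space q" by (rule prob_space_coin_space)
  assume "\<not> ?thesis"
  then have "h_top E < cross_entropy q q" by (simp add: cross_entropy_def bin_entropy_def algebra_simps)
  then obtain s where s: "h_top E < s" "s < cross_entropy q q" using dense by blast
  have zero: "entropy_measure s E = 0" by (rule entropy_measure_above [OF E s(1)])
  have prob_nonneg: "coin_prob q m b \<ge> 0" for m b using q by (simp add: coin_prob_def)
  \<comment> \<open>The points whose cylinder masses obey the exponential bound from order
    \<open>N\<close> on. They exhaust almost the whole space as \<open>N\<close> grows, so some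
    \<open>G N\<close> has positive mass.\<close>
  define G where "G N = {\<eta>. \<forall>n\<ge>N. coin_weight q n \<eta> \<le> exp (- s * real n)}" for N
  have [measurable]: "(\<lambda>\<eta>. coin_prob q m (\<eta> m)) \<in> borel_measurable (coin_space q)" for m
    by (rule measurable_compose [OF measurable_coin]) simp
  have [measurable]: "coin_weight q n \<in> borel_measurable (coin_space q)" for n
    unfolding coin_weight_def by measurable
  have G [measurable]: "G N \<in> sets (coin_space q)" for N
  proof -
    have "{\<eta> \<in> space (coin_space q). \<forall>n\<ge>N. coin_weight q n \<eta> \<le> exp (- s * real n)} \<in> sets (coin_space q)"
      by measurable
    then show ?thesis by (simp add: G_def)
  qed
  have "AE \<eta> in coin_space q. \<eta> \<in> (\<Union>N. G N)"
    using AE_coin_average_tendsto [OF q]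
  proof eventually_elim
    case (elim \<eta>)
    have "eventually (\<lambda>n. (\<Sum>m=1..n. ln (coin_prob q m (\<eta> m))) / real n < - s) sequentially"
      using s(2) by (intro order_tendstoD [OF sum_ln_coin_prob_tendsto [OF elim]]) simp
    then have "eventually (\<lambda>n. coin_weight q n \<eta> \<le> exp (- s * real n)) sequentially"
      using eventually_gt_at_top [of 0]
    proof eventually_elim
      case (elim n)
      have "coin_weight q n \<eta> \<le> (\<Prod>m=1..n. exp (ln (coin_prob q m (\<eta> m))))"
        unfolding coin_weight_def
      proof (rule prod_mono)
        fix m assume "m \<in> {1..n}"
        \<comment> \<open>At probability 0 the junk value \<open>ln 0 = 0\<close> makes the right-hand side 1.\<close>
        show "0 \<le> coin_prob q m (\<eta> m) \<and> coin_prob q m (\<eta> m) \<le> exp (ln (coin_prob q m (\<eta> m)))"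
          using prob_nonneg [of m "\<eta> m"] by (cases "coin_prob q m (\<eta> m) = 0") auto
      qed
      also have "\<dots> = exp (\<Sum>m=1..n. ln (coin_prob q m (\<eta> m)))" by (simp add: exp_sum)
      also have "\<dots> \<le> exp (- s * real n)" using elim by (simp add: pos_divide_less_eq)
      finally show ?case .
    qed
    then show ?case by (auto simp: G_def eventually_sequentially)
  qed
  then have "emeasure (coin_space q) (\<Union>N. G N) \<noteq> 0"
    by (subst emeasure_eq_1_AE) auto
  then obtain N where N: "emeasure (coin_space q) (G N) \<noteq> 0"
    using emeasure_UN_eq_0 [of "coin_space q" G] G by (metis image_subsetI)
  \<comment> \<open>Every cover by cylinders of order at least \<open>N\<close> costs at least the
    mass of \<open>G N\<close>, which contradicts the vanishing of the entropy measure at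
    \<open>s\<close>.\<close>
  have "emeasure (coin_space q) (G N) \<le> entropy_premeasure s N E"
    unfolding entropy_premeasure_def
  proof (rule Inf_greatest, clarify)
    fix I :: "nat set" and n x
    assume *: "\<forall>i\<in>I. n i \<ge> N \<and> x i \<in> bin_seqs" "E \<subseteq> (\<Union>i\<in>I. cylinder (n i) (x i))"
    define P where "P i \<eta> \<longleftrightarrow> i \<in> I \<and> \<eta> \<in> G N \<and> chain_seq \<eta> \<in> cylinder (n i) (x i)" for i \<eta>
    define a where "a i = (SOME \<eta>. P i \<eta>)" for i
    \<comment> \<open>A covering cylinder that contains the image of a point of \<open>G N\<close>
      is replaced by the coin cylinder around such a point \<open>a i\<close>, to which the mass
      bound applies. The other cylinders are replaced by the empty set.\<close>
    define K where "K i = (if \<exists>\<eta>. P i \<eta> then {\<eta>. \<forall>m\<in>{1..n i}. \<eta> m = a i m} else {})" for i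
    have K [measurable]: "K i \<in> sets (coin_space q)" for i
    proof -
      have "{\<eta> \<in> space (coin_space q). \<forall>m\<in>{1..n i}. \<eta> m = a i m} \<in> sets (coin_space q)"
        by measurable
      then show ?thesis by (simp add: K_def)
    qed
    have K_le: "emeasure (coin_space q) (K i) \<le> (if i \<in> I then ennreal (exp (- s * real (n i))) else 0)" for i
    proof (cases "\<exists>\<eta>. P i \<eta>")
      case True
      then have "P i (a i)" unfolding a_def by (rule someI_ex)
      then have i: "i \<in> I" and "coin_weight q (n i) (a i) \<le> exp (- s * real (n i))"
        using * by (auto simp: P_def G_def)
      moreover have "emeasure (coin_space q) (K i) = ennreal (coin_weight q (n i) (a i))"
        using True emeasure_coin_cylinder [OF q, of "n i" "a i"] by (simp add: K_def)
      ultimately show ?thesis by (simp add: ennreal_leI)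
    qed (simp add: K_def)
    have "AE \<eta> in coin_space q. \<eta> \<in> G N \<longrightarrow> \<eta> \<in> (\<Union>i. K i)"
      using AE_E
    proof eventually_elim
      case (elim \<eta>)
      show ?case
      proof
        assume "\<eta> \<in> G N"
        obtain i where i: "i \<in> I" "chain_seq \<eta> \<in> cylinder (n i) (x i)" using elim *(2) by auto
        then have "P i \<eta>" using \<open>\<eta> \<in> G N\<close> by (simp add: P_def)
        then have "P i (a i)" unfolding a_def by (rule someI [of "P i"])
        \<comment> \<open>The first \<open>n i\<close> letters determine the first
          \<open>n i\<close> coins.\<close>
        have "\<eta> m = a i m" if "m \<in> {1..n i}" for m
        proof -
          have "chain_seq \<eta> j = chain_seq (a i) j" if "j \<in> {1..n i}" for j
            using i \<open>P i (a i)\<close> that by (simp add: P_def cylinder_def)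
          then have "chain_code (chain_seq \<eta>) m = chain_code (chain_seq (a i)) m"
            using that by (rule chain_code_cong)
          then show ?thesis using that by (simp add: chain_code_chain_seq)
        qed
        then have "\<eta> \<in> K i" using \<open>P i \<eta>\<close> by (auto simp: K_def)
        then show "\<eta> \<in> (\<Union>i. K i)" by blast
      qed
    qed
    then have "emeasure (coin_space q) (G N) \<le> emeasure (coin_space q) (\<Union>i. K i)"
      by (intro emeasure_mono_AE) auto
    also have "\<dots> \<le> (\<Sum>i. emeasure (coin_space q) (K i))"
      by (intro emeasure_subadditive_countably) auto
    also have "\<dots> \<le> (\<Sum>\<^sub>\<infinity>i\<in>I. ennreal (exp (- s * real (n i))))"
      unfolding suminf_eq_SUP
    proof (rule SUP_least)
      fix k
      have "(\<Sum>i<k. emeasure (coin_space q) (K i)) \<le> (\<Sum>i<k. if i \<in> I then ennreal (exp (- s * real (n i))) else 0)"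
        by (intro sum_mono K_le)
      also have "\<dots> = (\<Sum>i\<in>{..<k} \<inter> I. ennreal (exp (- s * real (n i))))"
        by (rule sum.inter_restrict [symmetric]) simp
      also have "\<dots> \<le> (\<Sum>\<^sub>\<infinity>i\<in>I. ennreal (exp (- s * real (n i))))"
        by (subst nonneg_infsum_complete) (auto intro!: SUP_upper)
      finally show "(\<Sum>i<k. emeasure (coin_space q) (K i)) \<le> (\<Sum>\<^sub>\<infinity>i\<in>I. ennreal (exp (- s * real (n i))))" .
    qed
    finally show "emeasure (coin_space q) (G N) \<le> (\<Sum>\<^sub>\<infinity>i\<in>I. ennreal (exp (- s * real (n i))))" .
  qed
  also have "\<dots> \<le> entropy_measure s E" by (rule entropy_premeasure_le_measure)
  finally show False using N zero by simp
qed

section \<open>Almost sure normality\<close>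

text \<open>For positive \<open>m\<close>, the positions m, m/2, m/4, ... down to the odd part of
  \<open>m\<close>.\<close>

definition chain_below :: "nat \<Rightarrow> nat set" where
  "chain_below m = {l. \<exists>j. m = l * 2 ^ j}"

lemma chain_below_odd: "odd m \<Longrightarrow> chain_below m = {m}"
proof -
  assume "odd m"
  have "l = m" if "m = l * 2 ^ j" for l j
    using \<open>odd m\<close> that by (cases j) auto
  moreover have "\<exists>j. m = m * 2 ^ j" by (rule exI [of _ 0]) simp
  ultimately show ?thesis unfolding chain_below_def by blast
qed

lemma chain_below_even:
  assumes "even m"
  shows "chain_below m = insert m (chain_below (m div 2))"
proof (intro equalityI subsetI)
  fix l assume "l \<in> chain_below m"
  then obtain j where j: "m = l * 2 ^ j" by (auto simp: chain_below_def)
  show "l \<in> insert m (chain_below (m div 2))"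
  proof (cases j)
    case (Suc i)
    then have "m div 2 = l * 2 ^ i" using j by simp
    then show ?thesis by (auto simp: chain_below_def)
  qed (use j in simp)
next
  fix l assume "l \<in> insert m (chain_below (m div 2))"
  then consider "l = m" | j where "m div 2 = l * 2 ^ j" by (auto simp: chain_below_def)
  then show "l \<in> chain_below m"
  proof cases
    case 1
    then show ?thesis by (auto simp: chain_below_def intro: exI [of _ 0])
  next
    case (2 j)
    then have "m = l * 2 ^ Suc j" using assms by (auto elim!: evenE)
    then show ?thesis unfolding chain_below_def by blast
  qed
qed

lemma chain_below_subset: "m > 0 \<Longrightarrow> chain_below m \<subseteq> {1..m}"
proof
  fix l assume "m > 0" "l \<in> chain_below m"
  then obtain j where "m = l * 2 ^ j" by (auto simp: chain_below_def)
  with \<open>m > 0\<close> show "l \<in> {1..m}" by (cases "l = 0") auto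
qed

text \<open>Each mismatch along the chain flips the sign of the letter, starting from the sign of
  the first coin.\<close>

lemma sign_chain_seq:
  "m > 0 \<Longrightarrow> 1 - 2 * real (chain_seq \<eta> m) = (\<Prod>l\<in>chain_below m. if \<eta> l then - 1 else 1)"
proof (induction m rule: less_induct)
  case (less m)
  show ?case
  proof (cases "odd m")
    case False
    then have d: "m div 2 > 0" "m div 2 < m" using less.prems by (auto elim!: evenE)
    have "finite (chain_below (m div 2))" "m \<notin> chain_below (m div 2)"
      using chain_below_subset [OF d(1)] d(2) by (auto intro: finite_subset)
    then show ?thesis
      using False less.IH [OF d(2,1)] less.prems chain_seq_le_1 [OF d(1), of \<eta>]
      by (auto simp: chain_below_even chain_seq_even of_nat_diff)
  qed (simp add: chain_below_odd chain_seq_odd)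
qed

text \<open>Factors are regrouped by coin: coin \<open>l\<close> occurs once for every window
  position whose chain passes through \<open>l\<close>.\<close>

lemma walsh_chain_seq:
  assumes "finite F" "k > 0" "\<And>i. i \<in> F \<Longrightarrow> k + i \<le> R"
  shows "walsh F (chain_seq \<eta>) k
    = (\<Prod>l=1..R. (if \<eta> l then - 1 else 1) ^ card {i \<in> F. l \<in> chain_below (k + i)})"
proof -
  have "walsh F (chain_seq \<eta>) k = (\<Prod>i\<in>F. \<Prod>l\<in>chain_below (k + i). if \<eta> l then - 1 else 1)"
    unfolding walsh_def using assms by (intro prod.cong refl sign_chain_seq) auto
  also have "\<dots> = (\<Prod>i\<in>F. \<Prod>l=1..R. if l \<in> chain_below (k + i) then (if \<eta> l then - 1 else 1) else 1)"
  proof (rule prod.cong)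
    fix i assume "i \<in> F"
    then have "chain_below (k + i) \<subseteq> {1..R}"
      using chain_below_subset [of "k + i"] assms by fastforce
    then show "(\<Prod>l\<in>chain_below (k + i). if \<eta> l then - 1 else 1)
        = (\<Prod>l=1..R. if l \<in> chain_below (k + i) then (if \<eta> l then - 1 else 1) else (1::real))"
      by (simp add: prod.inter_restrict [symmetric] Int_absorb1)
  qed simp
  also have "\<dots> = (\<Prod>l=1..R. \<Prod>i\<in>F. if l \<in> chain_below (k + i) then (if \<eta> l then - 1 else 1) else 1)"
    by (rule prod.swap)
  also have "\<dots> = (\<Prod>l=1..R. (if \<eta> l then - 1 else 1) ^ card {i \<in> F. l \<in> chain_below (k + i)})"
    using assms(1) by (intro prod.cong refl) (simp add: prod.inter_filter [symmetric])
  finally show ?thesis .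
qed

text \<open>
  Unless some position of the window at \<open>a\<close> lies in the chain of \<open>b + Max F\<close>, that chain meets the two
  windows only once, and flipping its first coin changes the sign of the product.
\<close>

lemma walsh_correlation_eq_0:
  assumes q: "0 \<le> q" "q \<le> 1" and F: "finite F" "F \<noteq> {}"
    and a: "0 < a" "a < b" "Max F < b"
    and chain: "\<And>i j. i \<in> F \<Longrightarrow> (a + i) * 2 ^ j \<noteq> b + Max F"
  shows "(\<integral>\<eta>. walsh F (chain_seq \<eta>) a * walsh F (chain_seq \<eta>) b \<partial>coin_space q) = 0"
proof -
  define m where "m = b + Max F"
  have Max: "i \<le> Max F" if "i \<in> F" for i using F that by simp
  have "m \<noteq> 0" using a by (simp add: m_def)
  \<comment> \<open>The odd part \<open>o'\<close> is the start of the chain of \<open>m\<close>,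
    hence carries a fair coin.\<close>
  then obtain t o' where m: "odd o'" "m = o' * 2 ^ t"
  proof -
    have "\<not> is_unit (2::nat)" by simp
    from multiplicity_decompose' [OF \<open>m \<noteq> 0\<close> this] obtain y where "m = 2 ^ multiplicity 2 m * y" "\<not> 2 dvd y" by blast
    then show thesis using that [of y "multiplicity 2 m"] by (simp add: mult.commute)
  qed
  define c where "c l = card {i \<in> F. l \<in> chain_below (a + i)} + card {i \<in> F. l \<in> chain_below (b + i)}" for l
  have lt: "j < t" if "o' * 2 ^ j < m" for j
    using that m by (auto simp: power_less_imp_less_exp)
  have eq: "m = (o' * 2 ^ j) * 2 ^ (t - j)" if "j < t" for j
    using that m by (simp flip: power_add)
  \<comment> \<open>A position on this chain below \<open>m\<close> is \<open>m\<close> divided by a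
    power of 2, which \<open>chain\<close> excludes for the window at \<open>a\<close>.\<close>
  have e1: "{i \<in> F. o' \<in> chain_below (a + i)} = {}"
  proof safe
    fix i assume i: "i \<in> F" "o' \<in> chain_below (a + i)"
    then obtain j where j: "a + i = o' * 2 ^ j" by (auto simp: chain_below_def)
    have "a + i < m" using Max [OF i(1)] a by (simp add: m_def)
    then have "j < t" using j lt by simp
    then have "(a + i) * 2 ^ (t - j) = b + Max F" using eq j by (simp add: m_def)
    then show "i \<in> {}" using chain [OF i(1)] by blast
  qed
  \<comment> \<open>Any other position of the window at \<open>b\<close> on this chain would be at
    most \<open>m / 2\<close>, but \<open>Max F < b\<close> gives \<open>m < 2 * b\<close>.\<close>
  have e2: "{i \<in> F. o' \<in> chain_below (b + i)} = {Max F}"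
  proof safe
    fix i assume i: "i \<in> F" "o' \<in> chain_below (b + i)"
    then obtain j where j: "b + i = o' * 2 ^ j" by (auto simp: chain_below_def)
    show "i = Max F"
    proof (rule ccontr)
      assume "i \<noteq> Max F"
      then have "b + i < m" using Max [OF i(1)] by (simp add: m_def)
      then have "j < t" using j lt by simp
      then have "(b + i) * 2 ^ (t - j) = m" "(2::nat) ^ 1 \<le> 2 ^ (t - j)"
        using eq j by (simp, intro power_increasing, auto)
      then have "(b + i) * 2 \<le> m" using mult_le_mono2 [of 2 "2 ^ (t - j)" "b + i"] by simp
      then show False using a by (simp add: m_def)
    qed
  next
    show "Max F \<in> F" using F by simp
    show "o' \<in> chain_below (b + Max F)" using m by (auto simp: chain_below_def m_def)
  qed
  have co: "c o' = 1" unfolding c_def e1 e2 by simp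
  have "o' \<in> {1..m}" using m \<open>m \<noteq> 0\<close> by (auto simp: Suc_le_eq intro: Nat.gr0I)
  have "(\<integral>\<eta>. walsh F (chain_seq \<eta>) a * walsh F (chain_seq \<eta>) b \<partial>coin_space q)
      = (\<integral>\<eta>. (\<Prod>l=1..m. (if \<eta> l then - 1 else 1) ^ c l) \<partial>coin_space q)"
  proof (rule Bochner_Integration.integral_cong)
    fix \<eta> :: "nat \<Rightarrow> bool"
    have "walsh F (chain_seq \<eta>) k = (\<Prod>l=1..m. (if \<eta> l then - 1 else 1) ^ card {i \<in> F. l \<in> chain_below (k + i)})"
      if "k \<in> {a, b}" for k
      using that F a Max by (intro walsh_chain_seq) (auto simp: m_def intro: add_mono)
    then show "walsh F (chain_seq \<eta>) a * walsh F (chain_seq \<eta>) b = (\<Prod>l=1..m. (if \<eta> l then - 1 else 1) ^ c l)"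
      by (simp add: c_def power_add prod.distrib)
  qed simp
  also have "\<dots> = (\<Prod>l=1..m. coin_prob q l True * (if True then - 1 else 1) ^ c l
      + coin_prob q l False * (if False then - 1 else 1) ^ c l)"
    by (rule integral_coin_space_prod [OF q, where f = "\<lambda>l b. (if b then - 1 else 1) ^ c l"]) simp
  \<comment> \<open>The fair coin at \<open>o'\<close> has exponent 1, so its factor is -1/2 +
    1/2.\<close>
  also have "\<dots> = 0"
    using co m(1) \<open>o' \<in> {1..m}\<close> by (intro prod_zero) (auto simp: coin_prob_def intro!: bexI [of _ o'])
  finally show ?thesis .
qed

text \<open>A crude bound for the binary logarithm, sufficient for the square root in the strong
  law: \<open>j\<close> is at most \<open>2 * 2 ^ (j div 2)\<close>, whose square is at most
  \<open>4 * 2 ^ j\<close>.\<close>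

lemma exponent_le_sqrt:
  assumes "2 ^ j \<le> m"
  shows "real j \<le> 2 * sqrt (real m)"
proof -
  have "j div 2 + 1 \<le> 2 ^ (j div 2)" using less_exp [of "j div 2"] by linarith
  moreover have "j \<le> 2 * (j div 2 + 1)" by presburger
  ultimately have "j \<le> 2 * 2 ^ (j div 2)" by linarith
  then have "j\<^sup>2 \<le> (2 * 2 ^ (j div 2))\<^sup>2" by (rule power_mono) simp
  also have "\<dots> = 4 * 2 ^ (j div 2 * 2)" by (simp add: power_mult power_mult_distrib)
  also have "\<dots> \<le> 4 * 2 ^ j" by (intro mult_left_mono power_increasing) auto
  also have "\<dots> \<le> 4 * m" using assms by simp
  finally have "real (j\<^sup>2) \<le> real (4 * m)" by (simp only: of_nat_le_iff)
  then have "sqrt ((real j)\<^sup>2) \<le> sqrt (4 * real m)" by (intro real_sqrt_le_mono) simp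
  then show ?thesis by (simp add: real_sqrt_mult)
qed

text \<open>Such an \<open>a\<close> is determined by \<open>i\<close> and \<open>j\<close>, and
  only logarithmically many exponents \<open>j\<close> are possible.\<close>

lemma card_chain_related_le:
  assumes F: "finite F" and b: "Max F < b"
  shows "real (card {a. 0 < a \<and> (\<exists>i\<in>F. \<exists>j. (a + i) * 2 ^ j = b + Max F)}) \<le> 6 * real (card F) * sqrt (real b)"
proof -
  define m where "m = b + Max F"
  define J where "J = {j. 2 ^ j \<le> m}"
  have "J \<subseteq> {..nat \<lfloor>2 * sqrt (real m)\<rfloor>}"
    using exponent_le_sqrt [of _ m] by (auto simp: J_def le_nat_iff le_floor_iff)
  then have finJ: "finite J" and "card J \<le> card {..nat \<lfloor>2 * sqrt (real m)\<rfloor>}"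
    by (rule finite_subset [OF _ finite_atMost], rule card_mono [OF finite_atMost])
  then have "real (card J) \<le> real (nat \<lfloor>2 * sqrt (real m)\<rfloor>) + 1"
    by (metis card_atMost of_nat_Suc of_nat_le_iff add.commute)
  also have "real (nat \<lfloor>2 * sqrt (real m)\<rfloor>) \<le> 2 * sqrt (real m)" by (intro of_nat_floor) simp
  \<comment> \<open>The constant 6 is 3 from absorbing the 1 here and 2 from
    \<open>m \<le> 4 * b\<close> below.\<close>
  also have "2 * sqrt (real m) + 1 \<le> 3 * sqrt (real m)" using b by (simp add: m_def)
  also have "sqrt (real m) \<le> sqrt (4 * real b)" using b by (intro real_sqrt_le_mono) (simp add: m_def)
  also have "sqrt (4 * real b) = 2 * sqrt (real b)" by (simp add: real_sqrt_mult)
  finally have J: "real (card J) \<le> 6 * sqrt (real b)" by simp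
  have "{a. 0 < a \<and> (\<exists>i\<in>F. \<exists>j. (a + i) * 2 ^ j = m)} \<subseteq> (\<lambda>(i, j). m div 2 ^ j - i) ` (F \<times> J)"
  proof
    fix a assume "a \<in> {a. 0 < a \<and> (\<exists>i\<in>F. \<exists>j. (a + i) * 2 ^ j = m)}"
    then obtain i j where a: "0 < a" "i \<in> F" "(a + i) * 2 ^ j = m" by blast
    have "j \<in> J" using a mult_le_mono1 [of 1 "a + i" "2 ^ j"] by (simp add: J_def)
    moreover have "a = m div 2 ^ j - i" unfolding a(3) [symmetric] by simp
    ultimately show "a \<in> (\<lambda>(i, j). m div 2 ^ j - i) ` (F \<times> J)" using a by (intro image_eqI [of _ _ "(i, j)"]) auto
  qed
  then have "card {a. 0 < a \<and> (\<exists>i\<in>F. \<exists>j. (a + i) * 2 ^ j = m)} \<le> card F * card J"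
    using F finJ surj_card_le [of "F \<times> J"] by (simp add: card_cartesian_product)
  then have "real (card {a. 0 < a \<and> (\<exists>i\<in>F. \<exists>j. (a + i) * 2 ^ j = m)}) \<le> real (card F) * real (card J)"
    by (simp only: of_nat_mult [symmetric] of_nat_le_iff)
  also have "\<dots> \<le> real (card F) * (6 * sqrt (real b))" using J by (intro mult_left_mono) auto
  finally show ?thesis by (simp add: m_def)
qed

lemma measurable_chain_seq [measurable]:
  "(\<lambda>\<eta>. chain_seq \<eta> m) \<in> measurable (coin_space q) (count_space UNIV)"
proof (induction m rule: less_induct)
  case (less m)
  consider "m = 0" | "odd m" | "even m" "m > 0" by blast
  then show ?case
  proof cases
    case 1
    then show ?thesis by (simp add: chain_seq.simps)
  next
    case 2
    then show ?thesis by (simp add: chain_seq_odd)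
  next
    case 3
    then have [measurable]: "(\<lambda>\<eta>. chain_seq \<eta> (m div 2)) \<in> measurable (coin_space q) (count_space UNIV)"
      by (intro less.IH) auto
    show ?thesis using 3 by (simp add: chain_seq_even)
  qed
qed

lemma AE_walsh_average_tendsto_0:
  assumes q: "0 \<le> q" "q \<le> 1" and F: "finite F" "F \<noteq> {}"
  shows "AE \<eta> in coin_space q. (\<lambda>N. (\<Sum>k=1..N. walsh F (chain_seq \<eta>) k) / real N) \<longlonglongrightarrow> 0"
proof -
  interpret prob_space "coin_space q" by (rule prob_space_coin_space)
  \<comment> \<open>Index 0 is set apart because the letter there is \<open>undefined\<close>, so
    the sign bound could fail.\<close>
  define X where "X k \<eta> = (if k = 0 then 0 else walsh F (chain_seq \<eta>) k)" for k \<eta>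
  define C where "C = 6 * real (card F) + real (Max F)"
  have "AE \<eta> in coin_space q. (\<lambda>n. (\<Sum>k=1..n. X k \<eta>) / real n) \<longlonglongrightarrow> 0"
  proof (rule AE_average_tendsto_0 [where C = C])
    show "X k \<in> borel_measurable (coin_space q)" for k unfolding X_def walsh_def by measurable
    show "\<bar>X k \<eta>\<bar> \<le> 1" for k \<eta>
    proof (cases "k = 0")
      case False
      have "\<bar>1 - 2 * real (chain_seq \<eta> (k + i))\<bar> \<le> 1" for i
        using bin_seqs_values [OF chain_seq_in_bin_seqs, of "k + i" \<eta>] False by auto
      then show ?thesis using False by (auto simp: X_def walsh_def abs_prod intro!: prod_le_1)
    qed (simp add: X_def)
    fix b :: nat assume "b \<ge> 1"
    let ?bad = "{a \<in> {1..<b}. expectation (\<lambda>\<eta>. X a \<eta> * X b \<eta>) \<noteq> 0}"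
    show "real (card ?bad) \<le> C * sqrt (real b)"
    proof (cases "Max F < b")
      case True
      have sub: "?bad \<subseteq> {a. 0 < a \<and> (\<exists>i\<in>F. \<exists>j. (a + i) * 2 ^ j = b + Max F)}"
      proof
        fix a assume "a \<in> ?bad"
        then have "0 < a" "a < b" "expectation (\<lambda>\<eta>. walsh F (chain_seq \<eta>) a * walsh F (chain_seq \<eta>) b) \<noteq> 0"
          using \<open>b \<ge> 1\<close> by (auto simp: X_def)
        then show "a \<in> {a. 0 < a \<and> (\<exists>i\<in>F. \<exists>j. (a + i) * 2 ^ j = b + Max F)}"
          using walsh_correlation_eq_0 [OF q F _ _ True, of a] by blast
      qed
      have "finite {a. 0 < a \<and> (\<exists>i\<in>F. \<exists>j. (a + i) * 2 ^ j = b + Max F)}"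
      proof (rule finite_subset)
        show "{a. 0 < a \<and> (\<exists>i\<in>F. \<exists>j. (a + i) * 2 ^ j = b + Max F)} \<subseteq> {..b + Max F}"
        proof (rule subsetI)
          fix a assume "a \<in> {a. 0 < a \<and> (\<exists>i\<in>F. \<exists>j. (a + i) * 2 ^ j = b + Max F)}"
          then obtain i j where "(a + i) * 2 ^ j = b + Max F" by blast
          then have "a + i \<le> b + Max F" using mult_le_mono2 [of 1 "2 ^ j" "a + i"] by simp
          then show "a \<in> {..b + Max F}" by simp
        qed
      qed simp
      then have "real (card ?bad) \<le> real (card {a. 0 < a \<and> (\<exists>i\<in>F. \<exists>j. (a + i) * 2 ^ j = b + Max F)})"
        using sub by (intro of_nat_mono card_mono)
      also have "\<dots> \<le> 6 * real (card F) * sqrt (real b)" by (rule card_chain_related_le [OF F(1) True])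
      also have "\<dots> \<le> C * sqrt (real b)" by (intro mult_right_mono) (auto simp: C_def)
      finally show ?thesis .
    next
      case False
      have "card ?bad \<le> card {1..<b}" by (intro card_mono) auto
      then have "real (card ?bad) \<le> real (Max F) * 1" using False by simp
      also have "\<dots> \<le> C * sqrt (real b)" using \<open>b \<ge> 1\<close> by (intro mult_mono) (auto simp: C_def)
      finally show ?thesis .
    qed
  qed
  then show ?thesis by (simp add: X_def)
qed

text \<open>There are only countably many finite sets \<open>F\<close>, so the exceptional null sets
  can be united.\<close>

lemma AE_chain_seq_normal:
  assumes "0 \<le> q" "q \<le> 1"
  shows "AE \<eta> in coin_space q. chain_seq \<eta> \<in> normal_seqs"
proof -
  have "AE \<eta> in coin_space q. \<forall>F\<in>{F. finite F \<and> F \<noteq> {}}.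
      (\<lambda>N. (\<Sum>k=1..N. walsh F (chain_seq \<eta>) k) / real N) \<longlonglongrightarrow> 0"
  proof (rule AE_ball_countable')
    show "countable {F :: nat set. finite F \<and> F \<noteq> {}}"
      by (rule countable_subset [OF _ countable_Collect_finite]) auto
  qed (use AE_walsh_average_tendsto_0 [OF assms] in auto)
  then show ?thesis
  proof eventually_elim
    case (elim \<eta>)
    then show ?case by (intro normal_if_walsh_average_tendsto_0 chain_seq_in_bin_seqs) simp
  qed
qed

text \<open>For bits, the indicator of x \<noteq> y is x + y - 2xy; by normality both linear
  averages tend to 1/2.\<close>

lemma mismatch_average_tendsto:
  assumes "\<omega> \<in> normal_seqs" "\<omega> \<in> level_set \<alpha>"
  shows "(\<lambda>n. (\<Sum>k=1..n. of_bool (\<omega> (2 * k) \<noteq> \<omega> k)) / real n) \<longlonglongrightarrow> 1 - 2 * \<alpha>"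
proof -
  have bin: "\<omega> \<in> bin_seqs" using assms by (simp add: level_set_def)
  have "(\<lambda>n. (\<Sum>k=1..n. real (\<omega> k)) / real n + (\<Sum>k=1..n. real (\<omega> (2 * k))) / real n
      - 2 * (1 / real n * (\<Sum>k=1..n. real (\<omega> k * \<omega> (2 * k))))) \<longlonglongrightarrow> 1 / 2 + 1 / 2 - 2 * \<alpha>"
    using assms by (intro tendsto_intros normal_average_tendsto_half normal_even_average_tendsto_half)
      (auto simp: level_set_def)
  also have "(\<lambda>n. (\<Sum>k=1..n. real (\<omega> k)) / real n + (\<Sum>k=1..n. real (\<omega> (2 * k))) / real n
      - 2 * (1 / real n * (\<Sum>k=1..n. real (\<omega> k * \<omega> (2 * k)))))
    = (\<lambda>n. (\<Sum>k=1..n. of_bool (\<omega> (2 * k) \<noteq> \<omega> k)) / real n)"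
  proof
    fix n
    have "(\<Sum>k=1..n. of_bool (\<omega> (2 * k) \<noteq> \<omega> k))
        = (\<Sum>k=1..n. real (\<omega> k) + real (\<omega> (2 * k)) - 2 * real (\<omega> k * \<omega> (2 * k)))"
    proof (rule sum.cong)
      fix k assume "k \<in> {1..n}"
      then show "of_bool (\<omega> (2 * k) \<noteq> \<omega> k) = real (\<omega> k) + real (\<omega> (2 * k)) - 2 * real (\<omega> k * \<omega> (2 * k))"
        using bin_seqs_values [OF bin, of k] bin_seqs_values [OF bin, of "2 * k"] by auto
    qed simp
    also have "\<dots> = (\<Sum>k=1..n. real (\<omega> k)) + (\<Sum>k=1..n. real (\<omega> (2 * k))) - 2 * (\<Sum>k=1..n. real (\<omega> k * \<omega> (2 * k)))"
      by (simp add: sum.distrib sum_subtractf sum_distrib_left)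
    finally show "(\<Sum>k=1..n. real (\<omega> k)) / real n + (\<Sum>k=1..n. real (\<omega> (2 * k))) / real n
        - 2 * (1 / real n * (\<Sum>k=1..n. real (\<omega> k * \<omega> (2 * k))))
      = (\<Sum>k=1..n. of_bool (\<omega> (2 * k) \<noteq> \<omega> k)) / real n"
      by (simp add: add_divide_distrib diff_divide_distrib del: sum_of_bool_eq)
  qed
  finally show ?thesis by simp
qed

text \<open>The same identity for bits, solved for the product.\<close>

lemma normal_in_level_set:
  assumes "\<omega> \<in> normal_seqs" "(\<lambda>n. (\<Sum>k=1..n. of_bool (\<omega> (2 * k) \<noteq> \<omega> k)) / real n) \<longlonglongrightarrow> q"
  shows "\<omega> \<in> level_set ((1 - q) / 2)"
proof -
  have bin: "\<omega> \<in> bin_seqs" using assms by (simp add: normal_seqs_def)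
  have "(\<lambda>n. ((\<Sum>k=1..n. real (\<omega> k)) / real n + (\<Sum>k=1..n. real (\<omega> (2 * k))) / real n
      - (\<Sum>k=1..n. of_bool (\<omega> (2 * k) \<noteq> \<omega> k)) / real n) / 2) \<longlonglongrightarrow> (1 / 2 + 1 / 2 - q) / 2"
    using assms by (intro tendsto_intros normal_average_tendsto_half normal_even_average_tendsto_half) auto
  also have "(\<lambda>n. ((\<Sum>k=1..n. real (\<omega> k)) / real n + (\<Sum>k=1..n. real (\<omega> (2 * k))) / real n
      - (\<Sum>k=1..n. of_bool (\<omega> (2 * k) \<noteq> \<omega> k)) / real n) / 2)
    = (\<lambda>n. 1 / real n * (\<Sum>k=1..n. real (\<omega> k * \<omega> (2 * k))))"
  proof
    fix n
    have "(\<Sum>k=1..n. real (\<omega> k * \<omega> (2 * k)))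
        = (\<Sum>k=1..n. (real (\<omega> k) + real (\<omega> (2 * k)) - of_bool (\<omega> (2 * k) \<noteq> \<omega> k)) / 2)"
    proof (rule sum.cong)
      fix k assume "k \<in> {1..n}"
      then show "real (\<omega> k * \<omega> (2 * k)) = (real (\<omega> k) + real (\<omega> (2 * k)) - of_bool (\<omega> (2 * k) \<noteq> \<omega> k)) / 2"
        using bin_seqs_values [OF bin, of k] bin_seqs_values [OF bin, of "2 * k"] by auto
    qed simp
    also have "\<dots> = ((\<Sum>k=1..n. real (\<omega> k)) + (\<Sum>k=1..n. real (\<omega> (2 * k))) - (\<Sum>k=1..n. of_bool (\<omega> (2 * k) \<noteq> \<omega> k))) / 2"
      by (simp add: sum.distrib sum_subtractf sum_divide_distrib [symmetric] del: sum_of_bool_eq)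
    finally show "((\<Sum>k=1..n. real (\<omega> k)) / real n + (\<Sum>k=1..n. real (\<omega> (2 * k))) / real n
        - (\<Sum>k=1..n. of_bool (\<omega> (2 * k) \<noteq> \<omega> k)) / real n) / 2
      = 1 / real n * (\<Sum>k=1..n. real (\<omega> k * \<omega> (2 * k)))"
      by (simp add: add_divide_distrib diff_divide_distrib del: sum_of_bool_eq)
  qed
  finally show ?thesis using bin by (simp add: level_set_def)
qed

section \<open>Entropies of the sets\<close>

lemma bin_entropy_one_minus: "bin_entropy (1 - t) = bin_entropy t"
  by (simp add: bin_entropy_def algebra_simps)

lemma AE_chain_seq_mismatch_average:
  assumes "0 \<le> q" "q \<le> 1"
  shows "AE \<eta> in coin_space q.
    (\<lambda>n. (\<Sum>k=1..n. of_bool (chain_seq \<eta> (2 * k) \<noteq> chain_seq \<eta> k)) / real n) \<longlonglongrightarrow> q"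
proof -
  have "(chain_seq \<eta> (2 * k) \<noteq> chain_seq \<eta> k) = \<eta> (2 * k)" if "k \<ge> 1" for \<eta> k
    using chain_code_chain_seq [of "2 * k" \<eta>] that by (simp add: chain_code_def)
  then have "(\<Sum>k=1..n. of_bool (chain_seq \<eta> (2 * k) \<noteq> chain_seq \<eta> k)) = (\<Sum>k=1..n. of_bool (\<eta> (2 * k)) :: real)"
    for \<eta> n by (intro sum.cong refl) simp
  then show ?thesis using AE_coin_average_tendsto [OF assms] by simp
qed

text \<open>The sets A and B constrain every index and not just a frequency; a degenerate coin meets
  the constraint almost surely at all indices at once.\<close>

lemma AE_coin_certain:
  assumes "q = of_bool b"
  shows "AE \<eta> in coin_space q. \<forall>k. \<eta> (2 * k) = b"
  unfolding AE_all_countable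
proof
  fix k :: nat
  have "AE x in measure_pmf (bernoulli_pmf (if odd (2 * k) then 1 / 2 else q)). x = b"
    unfolding AE_measure_pmf_iff
  proof
    fix y assume "y \<in> set_pmf (bernoulli_pmf (if odd (2 * k) then 1 / 2 else q))"
    then have "pmf (bernoulli_pmf q) y \<noteq> 0" by (simp add: set_pmf_iff)
    then show "y = b" using assms by (cases b; cases y) auto
  qed
  then show "AE \<eta> in coin_space q. \<eta> (2 * k) = b"
    unfolding coin_space_def by (rule AE_PiM_component [rotated 2]) (auto simp: prob_space_measure_pmf)
qed

text \<open>On normal sequences, level \<alpha> means mismatch frequency 1 - 2 \<alpha>, and the
  entropy function is symmetric under \<open>t\<close> to \<open>1 - t\<close>.\<close>

lemma h_top_normal_level_set:
  assumes "0 \<le> \<alpha>" "\<alpha> \<le> 1 / 2"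
  shows "h_top (normal_seqs \<inter> level_set \<alpha>) = 1 / 2 * ln 2 + 1 / 2 * bin_entropy (2 * \<alpha>)"
proof -
  let ?q = "1 - 2 * \<alpha>"
  have q: "0 \<le> ?q" "?q \<le> 1" using assms by auto
  have bin: "normal_seqs \<inter> level_set \<alpha> \<subseteq> bin_seqs" by (auto simp: level_set_def)
  have "AE \<eta> in coin_space ?q. chain_seq \<eta> \<in> normal_seqs \<inter> level_set \<alpha>"
    using AE_chain_seq_normal [OF q] AE_chain_seq_mismatch_average [OF q]
  proof eventually_elim
    case (elim \<eta>)
    then show ?case using normal_in_level_set [of "chain_seq \<eta>" ?q] by simp
  qed
  then have "h_top (normal_seqs \<inter> level_set \<alpha>) \<ge> 1 / 2 * ln 2 + 1 / 2 * bin_entropy ?q"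
    by (rule h_top_ge [OF bin q])
  moreover have "h_top (normal_seqs \<inter> level_set \<alpha>) \<le> 1 / 2 * ln 2 + 1 / 2 * bin_entropy ?q"
    by (rule h_top_le [OF bin q mismatch_average_tendsto]) auto
  ultimately show ?thesis unfolding bin_entropy_one_minus by linarith
qed

text \<open>Each product is at most its first factor, whose average tends to 1/2.\<close>

lemma normal_level_set_empty:
  assumes "1 / 2 < \<alpha>"
  shows "normal_seqs \<inter> level_set \<alpha> = {}"
proof -
  have "\<alpha> \<le> 1 / 2" if \<omega>: "\<omega> \<in> normal_seqs" "\<omega> \<in> level_set \<alpha>" for \<omega>
  proof (rule LIMSEQ_le)
    have bin: "\<omega> \<in> bin_seqs" using \<omega> by (simp add: level_set_def)
    show "(\<lambda>n. (1 / real n) * (\<Sum>k=1..n. real (\<omega> k * \<omega> (2 * k)))) \<longlonglongrightarrow> \<alpha>"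
      using \<omega> by (simp add: level_set_def)
    show "(\<lambda>n. (\<Sum>k=1..n. real (\<omega> k)) / real n) \<longlonglongrightarrow> 1 / 2"
      using \<omega>(1) by (rule normal_average_tendsto_half)
    have "(\<Sum>k=1..n. real (\<omega> k * \<omega> (2 * k))) \<le> (\<Sum>k=1..n. real (\<omega> k))" for n
    proof (rule sum_mono)
      fix k assume "k \<in> {1..n}"
      then show "real (\<omega> k * \<omega> (2 * k)) \<le> real (\<omega> k)"
        using bin_seqs_values [OF bin, of "2 * k"] by auto
    qed
    then show "\<exists>N. \<forall>n\<ge>N. (1 / real n) * (\<Sum>k=1..n. real (\<omega> k * \<omega> (2 * k))) \<le> (\<Sum>k=1..n. real (\<omega> k)) / real n"
      by (auto intro!: exI [of _ 0] divide_right_mono)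
  qed
  then show ?thesis using assms by fastforce
qed

text \<open>Coins of bias 1 make \<open>k\<close> and \<open>2 * k\<close> always disagree, so the
  product vanishes. Conversely, on normal sequences vanishing products force mismatch frequency 1,
  which gives the upper bound.\<close>

lemma h_top_normal_zero_product: "h_top (normal_seqs \<inter> zero_product_seqs) = 1 / 2 * ln 2"
proof -
  let ?E = "normal_seqs \<inter> zero_product_seqs"
  have bin: "?E \<subseteq> bin_seqs" by (auto simp: zero_product_seqs_def)
  have "AE \<eta> in coin_space 1. chain_seq \<eta> \<in> ?E"
    using AE_chain_seq_normal [of 1, simplified] AE_coin_certain [of 1 True, simplified]
  proof eventually_elim
    case (elim \<eta>)
    have "chain_seq \<eta> k * chain_seq \<eta> (2 * k) = 0" if "k \<ge> 1" for k
      using that elim bin_seqs_values [OF chain_seq_in_bin_seqs that, of \<eta>] by (auto simp: chain_seq_double)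
    then show ?case using elim by (simp add: zero_product_seqs_def chain_seq_in_bin_seqs)
  qed
  from h_top_ge [OF bin _ _ this] have "h_top ?E \<ge> 1 / 2 * ln 2" by simp
  moreover have "h_top ?E \<le> 1 / 2 * ln 2 + 1 / 2 * bin_entropy 1"
  proof (rule h_top_le [OF bin])
    fix \<omega> assume "\<omega> \<in> ?E"
    then have \<omega>: "\<omega> \<in> normal_seqs" "\<omega> \<in> bin_seqs" "\<And>k. k \<ge> 1 \<Longrightarrow> \<omega> k * \<omega> (2 * k) = 0"
      by (auto simp: zero_product_seqs_def)
    have "(\<Sum>k=1..n. real (\<omega> k * \<omega> (2 * k))) = 0" for n
      using \<omega>(3) by (intro sum.neutral) auto
    then have "\<omega> \<in> level_set 0" using \<omega>(2) by (simp add: level_set_def del: of_nat_mult)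
    note \<omega>(1) this
    from mismatch_average_tendsto [OF this]
    show "(\<lambda>n. (\<Sum>k=1..n. of_bool (\<omega> (2 * k) \<noteq> \<omega> k)) / real n) \<longlonglongrightarrow> 1" by simp
  qed auto
  ultimately show ?thesis by simp
qed

lemma doubling_invariantD:
  assumes "\<omega> \<in> doubling_invariant_seqs" "k \<ge> 1"
  shows "\<omega> (2 * k) = \<omega> k"
proof -
  have "\<forall>k\<ge>1. \<omega> k = \<omega> (2 * k)"
    using assms(1) unfolding doubling_invariant_seqs_def mem_Collect_eq by (rule conjunct2)
  from this [rule_format, OF assms(2)] show ?thesis by (rule sym)
qed

lemma normal_doubling_invariant_subset:
  "normal_seqs \<inter> doubling_invariant_seqs \<subseteq> level_set (1 / 2)"
proof
  fix \<omega> assume "\<omega> \<in> normal_seqs \<inter> doubling_invariant_seqs"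
  then have "\<omega> \<in> normal_seqs" and inv: "\<omega> \<in> doubling_invariant_seqs" by auto
  have "(\<Sum>k=1..n. of_bool (\<omega> (2 * k) \<noteq> \<omega> k)) = (0::real)" for n
    using doubling_invariantD [OF inv] by (intro sum.neutral) auto
  then have "(\<lambda>n. (\<Sum>k=1..n. of_bool (\<omega> (2 * k) \<noteq> \<omega> k)) / real n) \<longlonglongrightarrow> 0" by simp
  from normal_in_level_set [OF \<open>\<omega> \<in> normal_seqs\<close> this] show "\<omega> \<in> level_set (1 / 2)" by simp
qed

text \<open>The sandwich treats B and its normal part together: coins of bias 0 almost surely give
  normal points of B, and on B there is no mismatch at all.\<close>

lemma h_top_between_doubling_invariant:
  assumes "normal_seqs \<inter> doubling_invariant_seqs \<subseteq> E" "E \<subseteq> doubling_invariant_seqs"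
  shows "h_top E = 1 / 2 * ln 2"
proof -
  have bin: "E \<subseteq> bin_seqs" using assms(2) by (auto simp: doubling_invariant_seqs_def)
  have "AE \<eta> in coin_space 0. chain_seq \<eta> \<in> E"
    using AE_chain_seq_normal [of 0, simplified] AE_coin_certain [of 0 False, simplified]
  proof eventually_elim
    case (elim \<eta>)
    have "chain_seq \<eta> (2 * k) = chain_seq \<eta> k" if "k \<ge> 1" for k
      using that elim by (simp add: chain_seq_double)
    then have "chain_seq \<eta> \<in> doubling_invariant_seqs"
      by (simp add: doubling_invariant_seqs_def chain_seq_in_bin_seqs)
    then show ?case using elim assms(1) by blast
  qed
  from h_top_ge [OF bin _ _ this] have "h_top E \<ge> 1 / 2 * ln 2" by simp
  moreover have "h_top E \<le> 1 / 2 * ln 2 + 1 / 2 * bin_entropy 0"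
  proof (rule h_top_le [OF bin])
    fix \<omega> assume "\<omega> \<in> E"
    then have inv: "\<omega> \<in> doubling_invariant_seqs" using assms(2) by auto
    have "(\<Sum>k=1..n. of_bool (\<omega> (2 * k) \<noteq> \<omega> k)) = (0::real)" for n
      using doubling_invariantD [OF inv] by (intro sum.neutral) auto
    then show "(\<lambda>n. (\<Sum>k=1..n. of_bool (\<omega> (2 * k) \<noteq> \<omega> k)) / real n) \<longlonglongrightarrow> 0" by simp
  qed auto
  ultimately show ?thesis by simp
qed

theorem theorem1p3:
  shows "(\<forall>\<alpha>. 0 \<le> \<alpha> \<and> \<alpha> \<le> 1 / 2 \<longrightarrow>
            h_top (normal_seqs \<inter> level_set \<alpha>) = 1 / 2 * ln 2 + 1 / 2 * bin_entropy (2 * \<alpha>))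
       \<and> (\<forall>\<alpha>. 1 / 2 < \<alpha> \<and> \<alpha> \<le> 1 \<longrightarrow> normal_seqs \<inter> level_set \<alpha> = {})
       \<and> (h_top (normal_seqs \<inter> zero_product_seqs) = h_top (normal_seqs \<inter> level_set 0)
          \<and> h_top (normal_seqs \<inter> level_set 0) = 1 / 2 * ln 2)
       \<and> (normal_seqs \<inter> doubling_invariant_seqs \<subseteq> level_set (1 / 2)
          \<and> h_top (normal_seqs \<inter> doubling_invariant_seqs) = h_top (normal_seqs \<inter> level_set (1 / 2))
          \<and> h_top (normal_seqs \<inter> level_set (1 / 2)) = h_top doubling_invariant_seqs
          \<and> h_top doubling_invariant_seqs = 1 / 2 * ln 2)"
proof (intro conjI allI impI)
  have zero: "h_top (normal_seqs \<inter> level_set 0) = 1 / 2 * ln 2"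
    using h_top_normal_level_set [of 0] by simp
  have half: "h_top (normal_seqs \<inter> level_set (1 / 2)) = 1 / 2 * ln 2"
    using h_top_normal_level_set [of "1 / 2"] by simp
  have B: "h_top doubling_invariant_seqs = 1 / 2 * ln 2"
    by (rule h_top_between_doubling_invariant) auto
  show "h_top (normal_seqs \<inter> zero_product_seqs) = h_top (normal_seqs \<inter> level_set 0)"
    using zero h_top_normal_zero_product by simp
  show "h_top (normal_seqs \<inter> level_set 0) = 1 / 2 * ln 2" by (rule zero)
  show "h_top (normal_seqs \<inter> doubling_invariant_seqs) = h_top (normal_seqs \<inter> level_set (1 / 2))"
    unfolding half by (rule h_top_between_doubling_invariant) auto
  show "h_top (normal_seqs \<inter> level_set (1 / 2)) = h_top doubling_invariant_seqs"
    using half B by simp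
  show "h_top doubling_invariant_seqs = 1 / 2 * ln 2" by (rule B)
qed (use h_top_normal_level_set normal_level_set_empty normal_doubling_invariant_subset in auto)

end
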